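(* Let $k\ge 2$ be an integer, let $A_0(z),A_1(z),\dots,A_{k-1}(z)$ be entire functions, let $\lambda$ be a real number such that $\sigma_{(\alpha,\beta,\gamma)}[A_j]\ge\lambda$ for at least one $j\in\{0,\dots,k-1\}$, and let $$m=\max\{j : \sigma_{(\alpha,\beta,\gamma)}[A_j]\ge\lambda,\ j=0,\dots,k-1\}.$$ Then the equation $$f^{(k)}+A_{k-1}(z)f^{(k-1)}+\cdots+A_1(z)f'+A_0(z)f=0$$ possesses at most $m$ linearly independent entire solutions $f$ with $\sigma_{(\alpha(\log),\beta,\gamma)}[f]<\lambda$.
   Context: Notation: $\log^{[0]}x=x$, $\log^{[p]}x=\log(\log^{[p-1]}x)$. Let $L$ be the class of continuous non-negative functions $\alpha$ on $(-\infty,+\infty)$ such that, for some $x_0$, $\alpha(x)=\alpha(x_0)\ge 0$ for $x\le x_0$ and $\alpha(x)$ increases to $+\infty$ as $x_0\le x\to+\infty$. Write $\alpha\in L_1$ if $\alpha\in L$ and $\alpha(a+b)\le\alpha(a)+\alpha(b)+c$ for all $a,b\ge R_0$ and some fixed $c\in(0,+\infty)$; $\alpha\in L_2$ if $\alpha\in L$ and $\alpha(x+O(1))=(1+o(1))\alpha(x)$ as $x\to+\infty$; $\alpha\in L_3$ if $\alpha\in L$ and $\alpha(a+b)\le\alpha(a)+\alpha(b)$ for all $a,b\ge R_0$. Standing assumptions on $\alpha,\beta,\gamma$: (i) $\alpha\in L_1$, $\beta\in L_2$, $\gamma\in L_3$; (ii) as $x\to+\infty$: $\alpha(\log^{[p]}x)=o(\beta(\log\gamma(x)))$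 for $p\ge 2$, $\alpha(\log x)=o(\alpha(x))$, and $\alpha^{-1}(\kappa x)=o(\alpha^{-1}(x))$ for $0<\kappa<1$. For a meromorphic function $f$ on $\mathbb{C}$ with Nevanlinna characteristic $T(r,f)$, the $(\alpha,\beta,\gamma)$-order and the $(\alpha(\log),\beta,\gamma)$-order are $$\sigma_{(\alpha,\beta,\gamma)}[f]=\limsup_{r\to+\infty}\frac{\alpha(\log T(r,f))}{\beta(\log\gamma(r))},\qquad \sigma_{(\alpha(\log),\beta,\gamma)}[f]=\limsup_{r\to+\infty}\frac{\alpha(\log^{[2]}T(r,f))}{\beta(\log\gamma(r))}.$$ *)

theory Defs
  imports
    "HOL-Complex_Analysis.Complex_Analysis"
    "HOL-Library.Landau_Symbols"
    "HOL-Library.Function_Algebras"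
begin

text \<open>Functions \<^typ>\<open>complex \<Rightarrow> complex\<close> as a vector space over \<^typ>\<open>complex\<close>; this provides the
  library's notion of linear independence, \<open>cfun.independent\<close>.\<close>

global_interpretation cfun: vector_space "\<lambda>(c :: complex) (f :: complex \<Rightarrow> complex) z. c * f z"
  by unfold_locales (auto simp: fun_eq_iff algebra_simps)


section \<open>Nevanlinna characteristic\<close>

definition log_plus :: "real \<Rightarrow> real" where
  "log_plus x = max 0 (ln x)"

definition proximity :: "real \<Rightarrow> (complex \<Rightarrow> complex) \<Rightarrow> real" where
  "proximity r f =
     1 / (2 * pi) * integral {0..2 * pi} (\<lambda>\<theta>. log_plus (norm (f (of_real r * cis \<theta>))))"

definition pole_count :: "real \<Rightarrow> (complex \<Rightarrow> complex) \<Rightarrow> nat" where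
  "pole_count t f = (\<Sum>z\<in>{z. norm z \<le> t \<and> is_pole f z}. nat (- zorder f z))"

definition pole_counting :: "real \<Rightarrow> (complex \<Rightarrow> complex) \<Rightarrow> real" where
  "pole_counting r f =
     integral {0..r} (\<lambda>t. (real (pole_count t f) - real (pole_count 0 f)) / t)
     + real (pole_count 0 f) * ln r"

definition nevanlinna_T :: "real \<Rightarrow> (complex \<Rightarrow> complex) \<Rightarrow> real" where
  "nevanlinna_T r f = proximity r f + pole_counting r f"


section \<open>Growth scales\<close>

definition class_L :: "(real \<Rightarrow> real) set" where
  "class_L = {\<alpha>. continuous_on UNIV \<alpha> \<and> (\<forall>x. 0 \<le> \<alpha> x) \<and>
     (\<exists>x0. (\<forall>x\<le>x0. \<alpha> x = \<alpha> x0) \<and> strict_mono_on {x0..} \<alpha>) \<and>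
     filterlim \<alpha> at_top at_top}"

definition class_L1 :: "(real \<Rightarrow> real) set" where
  "class_L1 = {\<alpha> \<in> class_L. \<exists>R0. \<exists>c>0. \<forall>a\<ge>R0. \<forall>b\<ge>R0. \<alpha> (a + b) \<le> \<alpha> a + \<alpha> b + c}"

definition class_L2 :: "(real \<Rightarrow> real) set" where
  "class_L2 = {\<alpha> \<in> class_L.
     \<forall>h. h \<in> O[at_top](\<lambda>_. 1 :: real) \<longrightarrow> (\<lambda>x. \<alpha> (x + h x)) \<sim>[at_top] \<alpha>}"

definition class_L3 :: "(real \<Rightarrow> real) set" where
  "class_L3 = {\<alpha> \<in> class_L. \<exists>R0. \<forall>a\<ge>R0. \<forall>b\<ge>R0. \<alpha> (a + b) \<le> \<alpha> a + \<alpha> b}"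

text \<open>A function in \<^const>\<open>class_L\<close> is not injective on the whole line, but every value above its
  minimum has exactly one preimage. So \<open>inv \<alpha> y\<close> is the inverse function for all
  sufficiently large \<open>y\<close>, which is all that the asymptotic conditions below depend on.\<close>

definition admissible_scales ::
    "(real \<Rightarrow> real) \<Rightarrow> (real \<Rightarrow> real) \<Rightarrow> (real \<Rightarrow> real) \<Rightarrow> bool" where
  "admissible_scales \<alpha> \<beta> \<gamma> \<longleftrightarrow>
     \<alpha> \<in> class_L1 \<and> \<beta> \<in> class_L2 \<and> \<gamma> \<in> class_L3 \<and>
     (\<forall>p\<ge>2. (\<lambda>x. \<alpha> ((ln ^^ p) x)) \<in> o[at_top](\<lambda>x. \<beta> (ln (\<gamma> x)))) \<and>
     (\<lambda>x. \<alpha> (ln x)) \<in> o[at_top](\<alpha>) \<and>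
     (\<forall>\<kappa>. 0 < \<kappa> \<and> \<kappa> < 1 \<longrightarrow> (\<lambda>x. inv \<alpha> (\<kappa> * x)) \<in> o[at_top](\<lambda>x. inv \<alpha> x))"


section \<open>Orders of growth\<close>

text \<open>The characteristic of a nonconstant meromorphic function on the plane tends to infinity, so the
  logarithms are eventually taken at arguments greater than 1. For a constant function \<open>T(r,f)\<close>
  does not depend on \<open>r\<close>; whatever real values \<^const>\<open>ln\<close> has at nonpositive arguments, the
  numerators are then constant in \<open>r\<close> and both orders are 0, as they are under the usual reading
  \<open>\<alpha>(-\<infinity>) = \<alpha>(x\<^sub>0)\<close>.\<close>

definition abc_order ::
    "(real \<Rightarrow> real) \<Rightarrow> (real \<Rightarrow> real) \<Rightarrow> (real \<Rightarrow> real) \<Rightarrow> (complex \<Rightarrow> complex) \<Rightarrow> ereal" where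
  "abc_order \<alpha> \<beta> \<gamma> f =
     Limsup at_top (\<lambda>r. ereal (\<alpha> (ln (nevanlinna_T r f)) / \<beta> (ln (\<gamma> r))))"

definition abc_log_order ::
    "(real \<Rightarrow> real) \<Rightarrow> (real \<Rightarrow> real) \<Rightarrow> (real \<Rightarrow> real) \<Rightarrow> (complex \<Rightarrow> complex) \<Rightarrow> ereal" where
  "abc_log_order \<alpha> \<beta> \<gamma> f =
     Limsup at_top (\<lambda>r. ereal (\<alpha> (ln (ln (nevanlinna_T r f))) / \<beta> (ln (\<gamma> r))))"


section \<open>Linear differential equations\<close>

definition solves_lde :: "nat \<Rightarrow> (nat \<Rightarrow> complex \<Rightarrow> complex) \<Rightarrow> (complex \<Rightarrow> complex) \<Rightarrow> bool" where
  "solves_lde k A f \<longleftrightarrow>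
     (\<forall>z. (deriv ^^ k) f z + (\<Sum>j<k. A j z * (deriv ^^ j) f z) = 0)"

end

theory Submission
  imports Defs
begin

text \<open>If \<open>m + 1\<close> linearly independent solutions grow slowly, then reduction of order expresses \<open>A\<^sub>m\<close>
  through \<open>A\<^sub>j\<close> with \<open>j > m\<close> and logarithmic derivatives of finitely many entire functions (the pivots)
  built from the solutions by the operation \<open>g * h' - h * g'\<close>. Instead of estimating proximity functions
  of logarithmic derivatives outside an exceptional set, one finds a radius \<open>r\<close> comparable to \<open>R\<close> whose circle
  stays away from all zeros of the pivots. Around every point of this circle each pivot varies by at
  most a factor 3 on a disc of radius \<open>\<rho>\<close>, where \<open>1/\<rho>\<close> is polynomial in the logarithm of the
  maximum modulus, and Cauchy's inequality bounds all quotients that occur. Hence \<open>T(R, A\<^sub>m)\<close> is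
  at most a constant times the largest of 1, \<open>log T(dR, f\<^sub>i)\<close> and \<open>T(r, A\<^sub>j)\<close>, and the scales do not
  notice constant factors in \<open>T\<close> or in \<open>R\<close>.\<close>


section \<open>Zeros and oscillation of entire functions\<close>

text \<open>The orders are limits superior over all radii, so no set of radii may be discarded.
  Moving from \<open>R\<close> to a good \<open>r\<close> nearby is harmless because
  \<open>T(R, A\<^sub>m) \<le> 3 * T(r, A\<^sub>m)\<close> once \<open>r \<ge> 2 * R\<close>.
  Polynomial losses in \<open>1 / \<rho>\<close> are affordable because the logarithm of a power of
  \<open>log M\<close> has the size of \<open>log log M\<close>, hence of
  \<open>log T(dR, f\<^sub>i)\<close>. This is the one logarithm by which the order required of the
  solutions differs from the order of the coefficients. The leading coefficient 1 is treated as
  \<open>A\<^sub>k\<close>. At each point the equation then says that one jet functional annihilates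
  \<open>m + 1\<close> functions. Each reduction lowers the number of functions by one and removes
  the lowest coefficient; with one function left, the functional is solved for its lowest
  coefficient, which corresponds to \<open>A\<^sub>m\<close>. The numerators
  \<open>g * h' - h * g'\<close> stand for the derivatives of quotients \<open>(h / g)'\<close>,
  which would have poles. Thus all pivots are entire, and the maximum modulus alone controls both
  their zeros and their oscillation.\<close>

lemma Borel_Caratheodory_half:
  fixes h :: "complex \<Rightarrow> complex"
  assumes holo: "h holomorphic_on ball 0 T" and "A > 0" and "T > 0"
    and Re_less: "\<And>z. norm z < T \<Longrightarrow> Re (h z) < Re (h 0) + A"
    and z: "norm z \<le> T / 2"
  shows "norm (h z - h 0) \<le> 2 * A"
proof -
  \<comment> \<open>The Moebius map \<open>v / (2 * A - v)\<close> fixes 0 and takes the half-plane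
    \<open>Re v < A\<close> to the unit disc. Composed with \<open>h - h 0\<close> and a rescaling
    it gives a function to which the Schwarz lemma applies.\<close>
  define \<phi> where "\<phi> u = (h (of_real T * u) - h 0) / (2 * of_real A - (h (of_real T * u) - h 0))" for u
  have less: "norm v < norm (2 * of_real A - v)" if "Re v < A" for v
  proof -
    have "(Re v)\<^sup>2 < (2 * A - Re v)\<^sup>2"
      using that \<open>A > 0\<close> by (simp add: power2_eq_square algebra_simps)
    then show ?thesis by (simp add: cmod_def)
  qed
  have small: "norm (h (of_real T * u) - h 0) < norm (2 * of_real A - (h (of_real T * u) - h 0))"
    if "norm u < 1" for u
  proof (rule less)
    have "norm (of_real T * u) < T" using that \<open>T > 0\<close> by (simp add: norm_mult)
    from Re_less[OF this] show "Re (h (of_real T * u) - h 0) < A" by simp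
  qed
  have \<phi>_small: "norm (\<phi> u) < 1" if "norm u < 1" for u
  proof -
    have "0 < norm (2 * of_real A - (h (of_real T * u) - h 0))"
      using small[OF that] norm_ge_zero le_less_trans by blast
    then show ?thesis
      unfolding \<phi>_def using small[OF that] by (simp only: norm_divide divide_less_eq_1_pos)
  qed
  have hT: "(\<lambda>u. h (of_real T * u)) holomorphic_on ball 0 1"
    using \<open>T > 0\<close>
    by (intro holomorphic_on_compose_gen[OF _ holo, unfolded comp_def] holomorphic_intros)
       (auto simp: norm_mult)
  have "\<phi> holomorphic_on ball 0 1"
    unfolding \<phi>_def
  proof (intro holomorphic_intros hT)
    fix u :: complex assume "u \<in> ball 0 1"
    then show "2 * of_real A - (h (of_real T * u) - h 0) \<noteq> 0"
      using small[of u] norm_ge_zero[of "h (of_real T * u) - h 0"] by auto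
  qed
  moreover have "\<phi> 0 = 0" by (simp add: \<phi>_def)
  ultimately have "norm (\<phi> (z / of_real T)) \<le> norm (z / of_real T)"
    using z \<open>T > 0\<close> by (intro Schwarz_Lemma(1) \<phi>_small) (auto simp: norm_divide field_simps)
  also have "\<dots> \<le> 1 / 2" using z \<open>T > 0\<close> by (simp add: norm_divide field_simps)
  finally have half: "norm (\<phi> (z / of_real T)) \<le> 1 / 2" .
  define v where "v = h z - h 0"
  have \<phi>_eq: "\<phi> (z / of_real T) = v / (2 * of_real A - v)"
    using \<open>T > 0\<close> by (simp add: \<phi>_def v_def)
  have "norm (z / of_real T) < 1" using z \<open>T > 0\<close> by (simp add: norm_divide field_simps)
  from small[OF this] have "norm v < norm (2 * of_real A - v)"
    using \<open>T > 0\<close> by (simp add: v_def)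
  then have "0 < norm (2 * of_real A - v)"
    using norm_ge_zero le_less_trans by blast
  with half have "2 * norm v \<le> norm (2 * of_real A - v)"
    by (simp add: \<phi>_eq norm_divide field_simps)
  also have "\<dots> \<le> 2 * A + norm v"
    using norm_triangle_ineq4[of "2 * of_real A" v] \<open>A > 0\<close> by (simp add: norm_mult)
  finally show ?thesis by (simp add: v_def)
qed

text \<open>The factor \<open>1 - z/a\<close> has modulus at least 3 on the circle of radius \<open>4 * T\<close> and value 1 at the
  origin, so every division lowers the bound \<open>M\<close> by a factor 3 without changing the value at 0.\<close>

lemma divide_zero_factor:
  fixes W :: "complex \<Rightarrow> complex"
  assumes holo: "W holomorphic_on UNIV" and "W 0 \<noteq> 0" and a: "W a = 0" "norm a \<le> T"
    and M: "\<And>u. norm u \<le> 4 * T \<Longrightarrow> norm (W u) \<le> M"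
  obtains g where "g holomorphic_on UNIV" "\<And>z. W z = (1 - z / a) * g z" "g 0 = W 0"
    "\<And>u. norm u \<le> 4 * T \<Longrightarrow> norm (g u) \<le> M / 3"
proof -
  have "a \<noteq> 0" using a \<open>W 0 \<noteq> 0\<close> by auto
  then have "T > 0" using a(2) by (meson less_le_trans zero_less_norm_iff)
  define q where "q z = (if z = a then deriv W a else W z / (z - a))" for z
  have "(\<lambda>z. if z = a then deriv W a else W z / (z - a) - W a / (z - a)) holomorphic_on UNIV"
    by (rule pole_theorem[OF holo]) (auto simp: divide_simps)
  also have "(\<lambda>z. if z = a then deriv W a else W z / (z - a) - W a / (z - a)) = q"
    using a by (auto simp: q_def)
  finally have q: "q holomorphic_on UNIV" .
  define g where "g z = - a * q z" for z
  have g: "g holomorphic_on UNIV" unfolding g_def by (intro holomorphic_intros q)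
  have Wg: "W z = (1 - z / a) * g z" for z
    using \<open>a \<noteq> 0\<close> a by (auto simp: g_def q_def field_simps)
  have "norm (g u) \<le> M / 3" if "norm u \<le> 4 * T" for u
  proof (rule maximum_modulus_frontier[of g "cball 0 (4 * T)"])
    show "g holomorphic_on interior (cball 0 (4 * T))"
      using g by (rule holomorphic_on_subset) simp
    show "continuous_on (closure (cball 0 (4 * T))) g"
      using holomorphic_on_imp_continuous_on[OF g] continuous_on_subset by blast
    show "u \<in> cball 0 (4 * T)" using that by simp
    fix z assume "z \<in> frontier (cball (0::complex) (4 * T))"
    then have z: "norm z = 4 * T" using \<open>T > 0\<close> by (simp add: frontier_cball)
    have "4 \<le> norm (z / a)" using z a(2) \<open>a \<noteq> 0\<close> by (simp add: norm_divide field_simps)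
    also have "norm (z / a) \<le> norm (1 - z / a) + 1"
      using norm_triangle_ineq2[of "z / a" 1] by (simp add: norm_minus_commute)
    finally have 3: "3 \<le> norm (1 - z / a)" by simp
    have "3 * norm (g z) \<le> norm (1 - z / a) * norm (g z)" by (rule mult_right_mono[OF 3]) simp
    also have "\<dots> = norm (W z)" by (simp add: Wg norm_mult)
    also have "\<dots> \<le> M" using z by (intro M) simp
    finally show "norm (g z) \<le> M / 3" by simp
  qed auto
  moreover have "g 0 = W 0" using Wg[of 0] by simp
  ultimately show thesis using that g Wg by blast
qed

text \<open>Without zeros \<open>W\<close> is \<open>exp h\<close>, and the upper bound
  \<open>M\<close> bounds \<open>Re h\<close> from above. Borel-Caratheodory on the half disc, then
  Cauchy's inequality on discs of radius \<open>T / 4\<close>, bound \<open>deriv h\<close>, which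
  makes \<open>ln (norm (W z))\<close> Lipschitz. The summand 1 makes the bound on
  \<open>Re h\<close> strict and positive even for constant \<open>W\<close>.\<close>

lemma zero_free_Harnack:
  fixes W :: "complex \<Rightarrow> complex"
  assumes holo: "W holomorphic_on UNIV" and "T > 0"
    and nz: "\<And>u. norm u \<le> T \<Longrightarrow> W u \<noteq> 0"
    and M: "\<And>u. norm u \<le> T \<Longrightarrow> norm (W u) \<le> M"
    and zw: "norm z < T / 4" "norm w < T / 4"
  shows "norm (W w) \<le> norm (W z) * exp (norm (w - z) * (8 * (ln (M / norm (W 0)) + 1) / T))"
proof -
  obtain h where h: "h holomorphic_on ball 0 T" and Wh: "\<And>u. norm u < T \<Longrightarrow> exp (h u) = W u"
    by (rule holomorphic_logarithm_exists[of "ball 0 T" W 0])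
       (use nz \<open>T > 0\<close> holomorphic_on_subset[OF holo] in auto)
  have W0: "norm (W 0) > 0" using nz[of 0] \<open>T > 0\<close> by simp
  also have "norm (W 0) \<le> M" using M[of 0] \<open>T > 0\<close> by simp
  finally have "M > 0" .
  have lnW: "ln (norm (W u)) = Re (h u)" if "norm u < T" for u
    using Wh[OF that, symmetric] by (simp add: norm_exp_eq_Re)
  define X where "X = ln (M / norm (W 0))"
  have X: "X = ln M - Re (h 0)"
    using \<open>M > 0\<close> W0 lnW[of 0] \<open>T > 0\<close> by (simp add: X_def ln_div)
  have Re_h: "Re (h u) < Re (h 0) + (X + 1)" if "norm u < T" for u
  proof -
    have "Re (h u) \<le> ln M"
      using lnW[OF that] M[of u] nz[of u] that \<open>M > 0\<close> by (metis less_eq_real_def ln_le_cancel_iff zero_less_norm_iff)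
    then show ?thesis by (simp add: X)
  qed
  have "X \<ge> 0"
    using M[of 0] \<open>T > 0\<close> W0 \<open>M > 0\<close> by (simp add: X_def)
  have half: "norm (h u - h 0) \<le> 2 * (X + 1)" if "norm u \<le> T / 2" for u
    using Borel_Caratheodory_half[OF h _ \<open>T > 0\<close> Re_h that] \<open>X \<ge> 0\<close> by simp
  have deriv_bd: "norm (deriv h u) \<le> 8 * (X + 1) / T" if u: "norm u < T / 4" for u
  proof -
    have sub: "cball u (T / 4) \<subseteq> ball 0 T"
    proof
      fix x assume "x \<in> cball u (T / 4)"
      then have "norm x \<le> norm u + T / 4"
        using norm_triangle_ineq[of u "x - u"] by (simp add: dist_norm norm_minus_commute)
      then show "x \<in> ball 0 T" using u \<open>T > 0\<close> by simp
    qed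
    have hh: "(\<lambda>x. h x - h 0) holomorphic_on cball u (T / 4)"
      by (intro holomorphic_intros holomorphic_on_subset[OF h] sub)
    have "norm ((deriv ^^ 1) (\<lambda>x. h x - h 0) u) \<le> fact 1 * (2 * (X + 1)) / (T / 4) ^ 1"
    proof (rule Cauchy_inequality)
      show "(\<lambda>x. h x - h 0) holomorphic_on ball u (T / 4)"
        by (rule holomorphic_on_subset[OF hh]) auto
      show "continuous_on (cball u (T / 4)) (\<lambda>x. h x - h 0)"
        by (rule holomorphic_on_imp_continuous_on[OF hh])
      fix x assume "norm (u - x) = T / 4"
      then have "norm x \<le> norm u + T / 4"
        using norm_triangle_ineq[of u "x - u"] by (simp add: norm_minus_commute)
      then show "norm (h x - h 0) \<le> 2 * (X + 1)" using u by (intro half) simp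
    qed (use \<open>T > 0\<close> in auto)
    moreover have "deriv (\<lambda>x. h x - h 0) u = deriv h u"
    proof -
      have "h field_differentiable at u"
        using h u \<open>T > 0\<close> by (intro holomorphic_on_imp_differentiable_at[OF h]) auto
      then show ?thesis by simp
    qed
    ultimately show ?thesis by (simp add: field_simps)
  qed
  have "norm (h w - h z) \<le> 8 * (X + 1) / T * norm (w - z)"
  proof (rule field_differentiable_bound[of "ball 0 (T / 4)" h "deriv h"])
    fix x assume x: "x \<in> ball (0::complex) (T / 4)"
    then have "h field_differentiable at x"
      using \<open>T > 0\<close> by (intro holomorphic_on_imp_differentiable_at[OF h]) auto
    then show "(h has_field_derivative deriv h x) (at x within ball 0 (T / 4))"
      by (meson DERIV_deriv_iff_field_differentiable has_field_derivative_at_within)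
    show "norm (deriv h x) \<le> 8 * (X + 1) / T" using x by (intro deriv_bd) simp
  qed (use zw in auto)
  then have "Re (h w) \<le> Re (h z) + norm (w - z) * (8 * (X + 1) / T)"
    using complex_Re_le_cmod[of "h w - h z"] by (simp add: algebra_simps)
  then have "exp (Re (h w)) \<le> exp (Re (h z)) * exp (norm (w - z) * (8 * (X + 1) / T))"
    by (simp add: exp_add[symmetric])
  moreover have "norm (W z) = exp (Re (h z))" "norm (W w) = exp (Re (h w))"
    using Wh[of z] Wh[of w] zw \<open>T > 0\<close> by (auto simp: norm_exp_eq_Re[symmetric])
  ultimately show ?thesis by (simp add: X_def)
qed

lemma one_le_ln_3: "1 \<le> ln (3::real)"
  using exp_le by (simp add: ln_ge_iff)

text \<open>Induction on the number \<open>N\<close> of factors 3 by which \<open>M\<close> may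
  exceed \<open>norm (W 0)\<close>. Dividing out a zero uses up one of them, and for
  \<open>N = 0\<close> the assumption contradicts \<open>norm (W 0) \<le> M\<close>. Each division
  lowers \<open>X\<close> by \<open>ln 3 \<ge> 1\<close>, which pays both for the zero in the count
  and for the oscillation of the factor \<open>1 - z / a\<close> at distance \<open>\<delta>\<close>
  from \<open>a\<close>.\<close>

lemma zeros_and_Harnack:
  fixes W :: "complex \<Rightarrow> complex"
  assumes "W holomorphic_on UNIV" and "W 0 \<noteq> 0" and "T > 0"
    and "\<And>u. norm u \<le> 4 * T \<Longrightarrow> norm (W u) \<le> M"
  defines "X \<equiv> ln (M / norm (W 0))"
  shows "finite {a. norm a \<le> T \<and> W a = 0}"
    and "real (card {a. norm a \<le> T \<and> W a = 0}) \<le> X"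
    and "\<And>z w \<delta>. norm z < T / 4 \<Longrightarrow> norm w < T / 4 \<Longrightarrow> \<delta> > 0 \<Longrightarrow>
           (\<And>a. norm a \<le> T \<Longrightarrow> W a = 0 \<Longrightarrow> \<delta> \<le> norm (z - a)) \<Longrightarrow>
           norm (W w) \<le> norm (W z) * exp (norm (w - z) * (X / \<delta> + 8 * (X + 1) / T))"
proof -
  obtain N where "M / norm (W 0) < 3 ^ N"
    using real_arch_pow[of 3 "M / norm (W 0)"] by auto
  then have "M < 3 ^ N * norm (W 0)"
    using \<open>W 0 \<noteq> 0\<close> by (simp add: divide_less_eq)
  with assms(1,2,4) have
    "finite {a. norm a \<le> T \<and> W a = 0} \<and> real (card {a. norm a \<le> T \<and> W a = 0}) \<le> X \<and>
     (\<forall>z w \<delta>. norm z < T / 4 \<longrightarrow> norm w < T / 4 \<longrightarrow> \<delta> > 0 \<longrightarrow>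
           (\<forall>a. norm a \<le> T \<longrightarrow> W a = 0 \<longrightarrow> \<delta> \<le> norm (z - a)) \<longrightarrow>
           norm (W w) \<le> norm (W z) * exp (norm (w - z) * (X / \<delta> + 8 * (X + 1) / T)))"
    unfolding X_def
  proof (induction N arbitrary: W M)
    case 0
    have "norm (W 0) \<le> M" using \<open>T > 0\<close> by (intro "0.prems"(3)) simp
    with "0.prems"(4) show ?case by simp
  next
    case (Suc N)
    define X where "X = ln (M / norm (W 0))"
    have W0: "norm (W 0) > 0" using Suc.prems by simp
    have M0: "norm (W 0) \<le> M" using Suc.prems(3)[of 0] \<open>T > 0\<close> by simp
    with W0 have "M > 0" by linarith
    have "X \<ge> 0" using W0 M0 by (simp add: X_def)
    show ?case
    proof (cases "\<exists>a. norm a \<le> T \<and> W a = 0")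
      case False
      then have E: "{a. norm a \<le> T \<and> W a = 0} = {}" by auto
      have "norm (W w) \<le> norm (W z) * exp (norm (w - z) * (X / \<delta> + 8 * (X + 1) / T))"
        if "norm z < T / 4" "norm w < T / 4" "\<delta> > 0" for z w \<delta>
      proof -
        have "norm (W w) \<le> norm (W z) * exp (norm (w - z) * (8 * (X + 1) / T))"
          unfolding X_def using False Suc.prems \<open>T > 0\<close> that by (intro zero_free_Harnack) auto
        also have "\<dots> \<le> norm (W z) * exp (norm (w - z) * (X / \<delta> + 8 * (X + 1) / T))"
          proof (intro mult_left_mono iffD2[OF exp_le_cancel_iff] norm_ge_zero)
          have "0 \<le> X / \<delta>" using \<open>X \<ge> 0\<close> that by simp
          then show "8 * (X + 1) / T \<le> X / \<delta> + 8 * (X + 1) / T" by linarith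
        qed
        finally show ?thesis .
      qed
      then show ?thesis using \<open>X \<ge> 0\<close> unfolding E X_def by simp
    next
      case True
      then obtain a where a: "norm a \<le> T" "W a = 0" by blast
      obtain g where g: "g holomorphic_on UNIV" "\<And>z. W z = (1 - z / a) * g z" "g 0 = W 0"
        "\<And>u. norm u \<le> 4 * T \<Longrightarrow> norm (g u) \<le> M / 3"
      proof (rule divide_zero_factor[OF Suc.prems(1,2) a(2,1), of M])
        show "norm (W u) \<le> M" if "norm u \<le> 4 * T" for u using that by (rule Suc.prems(3))
      qed (rule that; blast)
      have "a \<noteq> 0" using a Suc.prems(2) by auto
      have X3: "ln (M / 3 / norm (g 0)) = X - ln 3"
        using \<open>M > 0\<close> W0 by (simp add: X_def g(3) ln_div ln_mult)
      have g0: "g 0 \<noteq> 0" and less: "M / 3 < 3 ^ N * norm (g 0)"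
        using Suc.prems(2,4) by (simp_all add: g(3))
      have IH: "finite {a. norm a \<le> T \<and> g a = 0} \<and> real (card {a. norm a \<le> T \<and> g a = 0}) \<le> X - ln 3 \<and>
        (\<forall>z w \<delta>. norm z < T / 4 \<longrightarrow> norm w < T / 4 \<longrightarrow> \<delta> > 0 \<longrightarrow>
           (\<forall>a. norm a \<le> T \<longrightarrow> g a = 0 \<longrightarrow> \<delta> \<le> norm (z - a)) \<longrightarrow>
           norm (g w) \<le> norm (g z) * exp (norm (w - z) * ((X - ln 3) / \<delta> + 8 * (X - ln 3 + 1) / T)))"
        unfolding X3[symmetric] by (rule Suc.IH[OF g(1) g0 _ less]) (rule g(4))
      note fin = IH[THEN conjunct1] and card = IH[THEN conjunct2, THEN conjunct1]
        and harnack = IH[THEN conjunct2, THEN conjunct2, rule_format]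
      have sub: "{a. norm a \<le> T \<and> W a = 0} \<subseteq> insert a {a. norm a \<le> T \<and> g a = 0}"
        using g(2) \<open>a \<noteq> 0\<close> by auto
      have "card {a. norm a \<le> T \<and> W a = 0} \<le> card (insert a {a. norm a \<le> T \<and> g a = 0})"
        by (rule card_mono[OF _ sub]) (simp add: fin)
      also have "\<dots> \<le> Suc (card {a. norm a \<le> T \<and> g a = 0})" by (rule card_insert_le_m1) auto
      finally have "real (card {a. norm a \<le> T \<and> W a = 0}) \<le> X"
        using card one_le_ln_3 by linarith
      moreover have "finite {a. norm a \<le> T \<and> W a = 0}"
        using finite_subset[OF sub] fin by simp
      moreover have "norm (W w) \<le> norm (W z) * exp (norm (w - z) * (X / \<delta> + 8 * (X + 1) / T))"
        if zw: "norm z < T / 4" "norm w < T / 4" "\<delta> > 0"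
          and \<delta>: "\<forall>a. norm a \<le> T \<longrightarrow> W a = 0 \<longrightarrow> \<delta> \<le> norm (z - a)" for z w \<delta>
      proof -
        define d where "d = norm (w - z)"
        have za: "\<delta> \<le> norm (z - a)" using \<delta> a by blast
        have "norm (1 - w / a) = norm (a - w) / norm a" "norm (1 - z / a) = norm (z - a) / norm a"
          using \<open>a \<noteq> 0\<close> by (simp_all add: norm_divide[symmetric] diff_divide_distrib norm_minus_commute)
        moreover have "norm (a - w) \<le> norm (z - a) * exp (d / \<delta>)"
        proof -
          have "norm (a - w) \<le> norm (z - a) + d"
            using norm_triangle_ineq[of "a - z" "z - w"] by (simp add: d_def norm_minus_commute)
          also have "\<dots> = norm (z - a) + \<delta> * (d / \<delta>)" using zw by simp
          also have "\<dots> \<le> norm (z - a) + norm (z - a) * (d / \<delta>)"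
            using za zw by (intro add_left_mono mult_right_mono) (auto simp: d_def)
          also have "\<dots> = norm (z - a) * (1 + d / \<delta>)" by (simp add: algebra_simps)
          also have "\<dots> \<le> norm (z - a) * exp (d / \<delta>)" by (intro mult_left_mono exp_ge_add_one_self) simp
          finally show ?thesis .
        qed
        ultimately have 1: "norm (1 - w / a) \<le> norm (1 - z / a) * exp (d / \<delta>)"
          using \<open>a \<noteq> 0\<close> by (simp add: divide_right_mono)
        have 2: "norm (g w) \<le> norm (g z) * exp (d * ((X - ln 3) / \<delta> + 8 * (X - ln 3 + 1) / T))"
          unfolding d_def using zw \<delta> g(2) by (intro harnack) auto
        have "norm (W w) = norm (1 - w / a) * norm (g w)" by (simp add: g(2)[of w] norm_mult)
        also have "\<dots> \<le> (norm (1 - z / a) * exp (d / \<delta>)) *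
            (norm (g z) * exp (d * ((X - ln 3) / \<delta> + 8 * (X - ln 3 + 1) / T)))"
          by (intro mult_mono 1 2) auto
        also have "\<dots> = norm (W z) * exp (d / \<delta> + d * ((X - ln 3) / \<delta> + 8 * (X - ln 3 + 1) / T))"
          by (simp add: g(2)[of z] norm_mult exp_add)
        \<comment> \<open>The removed factor adds 1 to the numerator \<open>X - ln 3\<close>, which
          stays below \<open>X\<close> because \<open>3 \<ge> e\<close>. This is why zeros in the
          disc of radius \<open>T\<close> are compared with a bound on radius \<open>4 * T\<close>:
          a circle of radius \<open>3 * T\<close> would only give the factor 2.\<close>
        also have "d / \<delta> + d * ((X - ln 3) / \<delta> + 8 * (X - ln 3 + 1) / T)
            = d * ((X - (ln 3 - 1)) / \<delta> + 8 * (X - ln 3 + 1) / T)"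
          by (simp add: diff_divide_distrib add_divide_distrib algebra_simps)
        also have "norm (W z) * exp \<dots> \<le> norm (W z) * exp (d * (X / \<delta> + 8 * (X + 1) / T))"
          using one_le_ln_3 zw \<open>T > 0\<close>
          by (intro mult_left_mono iffD2[OF exp_le_cancel_iff] add_mono divide_right_mono)
             (simp_all add: d_def)
        finally show ?thesis by (simp add: d_def)
      qed
      ultimately show ?thesis unfolding X_def[symmetric] by simp
    qed
  qed
  then show "finite {a. norm a \<le> T \<and> W a = 0}"
    and "real (card {a. norm a \<le> T \<and> W a = 0}) \<le> X"
    and "\<And>z w \<delta>. norm z < T / 4 \<Longrightarrow> norm w < T / 4 \<Longrightarrow> \<delta> > 0 \<Longrightarrow>
           (\<And>a. norm a \<le> T \<Longrightarrow> W a = 0 \<Longrightarrow> \<delta> \<le> norm (z - a)) \<Longrightarrow>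
           norm (W w) \<le> norm (W z) * exp (norm (w - z) * (X / \<delta> + 8 * (X + 1) / T))"
    by blast+
qed


section \<open>Circles avoiding zeros\<close>

text \<open>The bound is two-sided so that Cauchy's inequality can be applied to \<open>W\<close>
  and to \<open>1 / W\<^sup>2\<close>; it also excludes zeros on the whole closed disc. The constant
  3 is an upper bound of \<open>exp 1\<close>.\<close>

definition steady :: "real \<Rightarrow> complex \<Rightarrow> (complex \<Rightarrow> complex) \<Rightarrow> bool" where
  "steady \<rho> z W \<longleftrightarrow> W z \<noteq> 0 \<and>
     (\<forall>w. norm (w - z) \<le> \<rho> \<longrightarrow> norm (W w) \<le> 3 * norm (W z) \<and> norm (W z) \<le> 3 * norm (W w))"

text \<open>Pigeonhole: \<open>card A + 1\<close> radii in the interval have mutual distance at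
  least \<open>h\<close>, and an element of \<open>A\<close> can be closer than \<open>h / 2\<close>
  to only one of them.\<close>

lemma radius_avoiding:
  fixes A :: "real set"
  assumes "finite A" and "R > 0"
  shows "\<exists>r. R \<le> r \<and> r \<le> 2 * R \<and> (\<forall>a\<in>A. R / (2 * (real (card A) + 1)) \<le> \<bar>r - a\<bar>)"
proof (rule ccontr)
  assume contra: "\<not> ?thesis"
  define h where "h = R / (real (card A) + 1)"
  have "h > 0" using \<open>R > 0\<close> by (simp add: h_def)
  define p where "p i = R + real i * h" for i :: nat
  have "\<exists>a\<in>A. \<bar>p i - a\<bar> < h / 2" if "i \<le> card A" for i
  proof -
    have "real i * h \<le> (real (card A) + 1) * h" using that \<open>h > 0\<close> by (intro mult_right_mono) auto
    also have "\<dots> = R" by (simp add: h_def)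
    finally have "R \<le> p i \<and> p i \<le> 2 * R" using \<open>h > 0\<close> by (simp add: p_def)
    moreover have "R / (2 * (real (card A) + 1)) = h / 2" by (simp add: h_def)
    ultimately show ?thesis using contra by (metis not_le)
  qed
  then obtain q where q: "\<And>i. i \<le> card A \<Longrightarrow> q i \<in> A \<and> \<bar>p i - q i\<bar> < h / 2" by metis
  have "inj_on q {..card A}"
  proof (rule inj_onI, rule ccontr)
    fix i j assume ij: "i \<in> {..card A}" "j \<in> {..card A}" "q i = q j" "i \<noteq> j"
    have "\<bar>p i - q i\<bar> < h / 2" "\<bar>p j - q j\<bar> < h / 2" using q ij(1,2) by auto
    then have "\<bar>p i - p j\<bar> < h" using ij(3) by linarith
    moreover have "\<bar>p i - p j\<bar> = \<bar>real i - real j\<bar> * h"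
      using \<open>h > 0\<close> by (simp add: p_def abs_mult left_diff_distrib[symmetric])
    moreover have "1 * h \<le> \<bar>real i - real j\<bar> * h"
      using ij(4) \<open>h > 0\<close> by (intro mult_right_mono) auto
    ultimately show False by simp
  qed
  moreover have "q ` {..card A} \<subseteq> A" using q by auto
  ultimately have "card {..card A} \<le> card A" using \<open>finite A\<close> by (metis card_inj_on_le)
  then show False by simp
qed

text \<open>Counting zeros requires a centre where the function does not vanish. A pivot may vanish
  at the origin, but by the identity theorem not on the whole unit disc, so a shift of the centre by
  at most 1 is enough.\<close>

lemma entire_nonzero_near_0:
  fixes W :: "complex \<Rightarrow> complex"
  assumes "W holomorphic_on UNIV" and "W z \<noteq> 0"
  obtains c where "norm c \<le> 1" "W c \<noteq> 0"
proof -
  have "\<exists>c. norm c \<le> 1 \<and> W c \<noteq> 0"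
  proof (rule ccontr)
    assume "\<not> ?thesis"
    then have zero: "W u = 0" if "u \<in> ball 0 1" for u using that by force
    have "W z = 0"
      by (rule analytic_continuation_open[of "ball 0 1" UNIV W "\<lambda>_. 0"])
         (simp_all only: zero assms(1) holomorphic_on_const connected_UNIV, simp_all)
    with \<open>W z \<noteq> 0\<close> show False by simp
  qed
  then show thesis using that by blast
qed

lemma steady_on_circle:
  fixes Ws :: "(complex \<Rightarrow> complex) set"
  assumes "finite Ws" and holo: "\<And>W. W \<in> Ws \<Longrightarrow> W holomorphic_on UNIV"
    and nz: "\<And>W. W \<in> Ws \<Longrightarrow> \<exists>z. W z \<noteq> 0"
  shows "\<exists>C\<ge>1. \<forall>R\<ge>2. \<forall>B\<ge>0. (\<forall>W\<in>Ws. \<forall>z. norm z \<le> 65 * R \<longrightarrow> norm (W z) \<le> exp B) \<longrightarrow>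
     (\<exists>r. R \<le> r \<and> r \<le> 2 * R \<and>
       (\<forall>z. norm z = r \<longrightarrow> (\<forall>W\<in>Ws. steady (1 / (9 * (C * (B + 1))\<^sup>2)) z W)))"
proof -
  have "\<forall>W\<in>Ws. \<exists>c. norm c \<le> 1 \<and> W c \<noteq> 0"
    using holo nz entire_nonzero_near_0 by metis
  then obtain c where c: "\<And>W. W \<in> Ws \<Longrightarrow> norm (c W) \<le> 1 \<and> W (c W) \<noteq> 0" by metis
  \<comment> \<open>The logarithms absorb the values at the shifted centres, so that
    \<open>X W \<le> C0 * (B + 1)\<close>. The factor \<open>card Ws + 1\<close> in \<open>C\<close>
    below makes \<open>Y\<close> a bound for the zeros of all pivots together.\<close>
  define C0 where "C0 = 1 + (\<Sum>W\<in>Ws. \<bar>ln (norm (W (c W)))\<bar>)"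
  have "C0 \<ge> 1" by (simp add: C0_def sum_nonneg)
  define C where "C = C0 * (real (card Ws) + 1)"
  have C0_le_C: "C0 \<le> C" using \<open>C0 \<ge> 1\<close> by (simp add: C_def)
  show ?thesis
  proof (rule exI[of _ C], intro conjI allI impI)
    show "C \<ge> 1" using \<open>C0 \<ge> 1\<close> C0_le_C by simp
    fix R B :: real
    assume "R \<ge> 2" "B \<ge> 0" and bound: "\<forall>W\<in>Ws. \<forall>z. norm z \<le> 65 * R \<longrightarrow> norm (W z) \<le> exp B"
    define Y where "Y = C * (B + 1)"
    \<comment> \<open>The circle has radius at most \<open>2 * R\<close>; after the shift by at most
      1, it and its small discs must lie within \<open>T / 4 = 4 * R\<close>. The bound on radius
      \<open>4 * T = 64 * R\<close> around the shifted centre is where \<open>65 * R\<close> comes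
      from.\<close>
    define T where "T = 16 * R"
    have "T > 0" "T \<ge> 32" using \<open>R \<ge> 2\<close> by (auto simp: T_def)
    have C0_le_Y: "C0 * (B + 1) \<le> Y"
      unfolding Y_def using C0_le_C \<open>B \<ge> 0\<close> by (intro mult_right_mono) auto
    have "1 * 1 \<le> C0 * (B + 1)" using \<open>C0 \<ge> 1\<close> \<open>B \<ge> 0\<close> by (intro mult_mono) auto
    then have "Y \<ge> 1" using C0_le_Y by simp
    define V where "V W u = W (c W + u)" for W u
    define X where "X W = ln (exp B / norm (V W 0))" for W
    have X_le: "X W \<le> C0 * (B + 1)" if "W \<in> Ws" for W
    proof -
      have "\<bar>ln (norm (W (c W)))\<bar> \<le> (\<Sum>W\<in>Ws. \<bar>ln (norm (W (c W)))\<bar>)"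
        using that \<open>finite Ws\<close> by (intro member_le_sum) auto
      then have "X W \<le> B + (C0 - 1)"
        using c[OF that] by (simp add: X_def V_def ln_div C0_def)
      also have "\<dots> \<le> C0 * B + C0"
        using mult_right_mono[OF \<open>C0 \<ge> 1\<close> \<open>B \<ge> 0\<close>] by simp
      finally show ?thesis by (simp add: algebra_simps)
    qed
    have V: "V W holomorphic_on UNIV" "V W 0 \<noteq> 0"
      "\<And>u. norm u \<le> 4 * T \<Longrightarrow> norm (V W u) \<le> exp B" if "W \<in> Ws" for W
    proof -
      show "V W holomorphic_on UNIV"
        unfolding V_def
        by (intro holomorphic_on_compose_gen[OF _ holo[OF that], unfolded comp_def] holomorphic_intros) auto
      show "V W 0 \<noteq> 0" using c[OF that] by (simp add: V_def)
      fix u :: complex assume "norm u \<le> 4 * T"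
      then have "norm (c W + u) \<le> 65 * R"
        using norm_triangle_ineq[of "c W" u] c[OF that] \<open>R \<ge> 2\<close> by (simp add: T_def)
      then show "norm (V W u) \<le> exp B" using bound that by (simp add: V_def)
    qed
    have ZH: "finite {a. norm a \<le> T \<and> V W a = 0}"
      "real (card {a. norm a \<le> T \<and> V W a = 0}) \<le> X W"
      "\<And>z w \<delta>. norm z < T / 4 \<Longrightarrow> norm w < T / 4 \<Longrightarrow> \<delta> > 0 \<Longrightarrow>
           (\<And>a. norm a \<le> T \<Longrightarrow> V W a = 0 \<Longrightarrow> \<delta> \<le> norm (z - a)) \<Longrightarrow>
           norm (V W w) \<le> norm (V W z) * exp (norm (w - z) * (X W / \<delta> + 8 * (X W + 1) / T))"
      if "W \<in> Ws" for W
    proof -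
      note ZH = zeros_and_Harnack[where W = "V W" and M = "exp B" and T = T,
        OF V(1)[OF that] V(2)[OF that] \<open>T > 0\<close>, folded X_def]
      show "finite {a. norm a \<le> T \<and> V W a = 0}" by (rule ZH(1)) (rule V(3)[OF that])
      show "real (card {a. norm a \<le> T \<and> V W a = 0}) \<le> X W" by (rule ZH(2)) (rule V(3)[OF that])
      show "norm (V W w) \<le> norm (V W z) * exp (norm (w - z) * (X W / \<delta> + 8 * (X W + 1) / T))"
        if "norm z < T / 4" "norm w < T / 4" "\<delta> > 0"
          "\<And>a. norm a \<le> T \<Longrightarrow> V W a = 0 \<Longrightarrow> \<delta> \<le> norm (z - a)" for z w \<delta>
        by (rule ZH(3)[OF V(3)[OF \<open>W \<in> Ws\<close>] that(1-3)]) (use that(4) in blast)+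
    qed
    \<comment> \<open>Moduli are taken from the origin and not from the shifted centre, because the
      distance of a zero to the circle of radius \<open>r\<close> about 0 is at least the difference
      of the moduli.\<close>
    define Z where "Z W = (\<lambda>a. norm (c W + a)) ` {a. norm a \<le> T \<and> V W a = 0}" for W
    define A where "A = (\<Union>W\<in>Ws. Z W)"
    have "finite A" using \<open>finite Ws\<close> ZH(1) by (auto simp: A_def Z_def)
    have "real (card A) \<le> real (\<Sum>W\<in>Ws. card (Z W))"
      unfolding A_def using card_UN_le[OF \<open>finite Ws\<close>] by (simp only: of_nat_le_iff)
    also have "\<dots> \<le> (\<Sum>W\<in>Ws. C0 * (B + 1))"
      unfolding of_nat_sum
    proof (rule sum_mono)
      fix W assume W: "W \<in> Ws"
      have "real (card (Z W)) \<le> real (card {a. norm a \<le> T \<and> V W a = 0})"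
        unfolding Z_def using ZH(1)[OF W] by (simp add: card_image_le)
      also have "\<dots> \<le> X W" using ZH(2)[OF W] .
      also have "\<dots> \<le> C0 * (B + 1)" using X_le[OF W] .
      finally show "real (card (Z W)) \<le> C0 * (B + 1)" .
    qed
    also have "\<dots> = (C0 * real (card Ws)) * (B + 1)" by simp
    also have "\<dots> \<le> Y"
      unfolding Y_def C_def using \<open>C0 \<ge> 1\<close> \<open>B \<ge> 0\<close>
      by (intro mult_right_mono mult_left_mono) auto
    finally have card_le: "real (card A) \<le> Y" .
    obtain r where r: "R \<le> r" "r \<le> 2 * R"
      and far: "\<And>a. a \<in> A \<Longrightarrow> R / (2 * (real (card A) + 1)) \<le> \<bar>r - a\<bar>"
      using radius_avoiding[OF \<open>finite A\<close>, of R] \<open>R \<ge> 2\<close> by auto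
    have "1 / (2 * Y) \<le> R / (2 * (real (card A) + 1))"
    proof -
      have "2 * (real (card A) + 1) \<le> 2 * (2 * Y)" using card_le \<open>Y \<ge> 1\<close> by simp
      also have "\<dots> \<le> R * (2 * Y)" using \<open>R \<ge> 2\<close> \<open>Y \<ge> 1\<close> by (intro mult_right_mono) auto
      finally show ?thesis using \<open>Y \<ge> 1\<close> by (simp add: field_simps)
    qed
    then have far: "1 / (2 * Y) \<le> \<bar>r - a\<bar>" if "a \<in> A" for a using far[OF that] by linarith
    \<comment> \<open>Points of the circle have distance at least \<open>1 / (2 * Y)\<close> from
      the zeros in question, and their \<open>\<rho>\<close>-discs keep half of it. With
      \<open>\<delta> = 1 / (4 * Y)\<close> the Harnack rate is at most
      \<open>4 * Y\<^sup>2 + Y / 2\<close>, hence at most \<open>9 * Y\<^sup>2\<close>, so the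
      exponent stays below 1 within \<open>\<rho>\<close>. Both ends keep away from the zeros
      because the inequality is used in both directions.\<close>
    define \<rho> where "\<rho> = 1 / (9 * Y\<^sup>2)"
    have "Y * 1 \<le> Y * Y" using \<open>Y \<ge> 1\<close> by (intro mult_left_mono) auto
    then have Y2: "Y \<le> Y\<^sup>2" by (simp add: power2_eq_square)
    have "\<rho> \<le> 1 / (4 * Y)"
      unfolding \<rho>_def using Y2 \<open>Y \<ge> 1\<close> by (intro divide_left_mono) auto
    have "1 / (4 * Y) \<le> 1" using \<open>Y \<ge> 1\<close> by simp
    have "steady \<rho> z W" if z: "norm z = r" and W: "W \<in> Ws" for z W
    proof -
      have zero_far: "1 / (2 * Y) \<le> norm (z - c W - a)" if "norm a \<le> T" "V W a = 0" for a
      proof -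
        have "norm (c W + a) \<in> A" using that W by (auto simp: A_def Z_def)
        from far[OF this] have "1 / (2 * Y) \<le> \<bar>norm z - norm (c W + a)\<bar>" by (simp add: z)
        also have "\<dots> \<le> norm (z - (c W + a))" by (rule norm_triangle_ineq3)
        finally show ?thesis by (simp add: algebra_simps)
      qed
      have exponent: "exp (d * (X W / (1 / (4 * Y)) + 8 * (X W + 1) / T)) \<le> 3" if "0 \<le> d" "d \<le> \<rho>" for d
      proof -
        have XY: "X W \<le> Y" using X_le[OF W] C0_le_Y by simp
        have "0 \<le> X W" using ZH(2)[OF W] by linarith
        have "X W / (1 / (4 * Y)) = 4 * (X W * Y)" by simp
        also have "\<dots> \<le> 4 * Y\<^sup>2"
          using XY \<open>Y \<ge> 1\<close> by (simp add: power2_eq_square mult_right_mono)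
        finally have 1: "X W / (1 / (4 * Y)) \<le> 4 * Y\<^sup>2" .
        have "8 * (X W + 1) / T \<le> 16 * Y / 32"
          using XY \<open>Y \<ge> 1\<close> \<open>T \<ge> 32\<close> \<open>0 \<le> X W\<close> by (intro frac_le) auto
        with 1 have "X W / (1 / (4 * Y)) + 8 * (X W + 1) / T \<le> 9 * Y\<^sup>2" using Y2 \<open>Y \<ge> 1\<close> by linarith
        moreover have "0 \<le> X W / (1 / (4 * Y)) + 8 * (X W + 1) / T"
          using \<open>0 \<le> X W\<close> \<open>Y \<ge> 1\<close> \<open>T > 0\<close> by (intro add_nonneg_nonneg divide_nonneg_pos) auto
        ultimately have "d * (X W / (1 / (4 * Y)) + 8 * (X W + 1) / T) \<le> \<rho> * (9 * Y\<^sup>2)"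
          using that by (intro mult_mono) auto
        also have "\<dots> = 1" using \<open>Y \<ge> 1\<close> by (simp add: \<rho>_def)
        finally have "exp (d * (X W / (1 / (4 * Y)) + 8 * (X W + 1) / T)) \<le> exp 1" by simp
        also have "\<dots> \<le> 3" by (rule exp_le)
        finally show ?thesis .
      qed
      have "norm (W w) \<le> 3 * norm (W z) \<and> norm (W z) \<le> 3 * norm (W w)" if w: "norm (w - z) \<le> \<rho>" for w
      proof -
        have small: "norm (z - c W) < T / 4" "norm (w - c W) < T / 4"
        proof -
          show "norm (z - c W) < T / 4"
            using norm_triangle_ineq4[of z "c W"] c[OF W] z r \<open>R \<ge> 2\<close> by (simp add: T_def)
          have "norm (w - c W) \<le> norm (w - z) + norm z + norm (c W)"
            using norm_triangle_ineq4[of w "c W"] norm_triangle_ineq[of "w - z" z] by simp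
          then show "norm (w - c W) < T / 4"
            using c[OF W] w z r \<open>R \<ge> 2\<close> \<open>\<rho> \<le> 1 / (4 * Y)\<close> \<open>1 / (4 * Y) \<le> 1\<close>
            by (simp add: T_def)
        qed
        have VW: "V W (z - c W) = W z" "V W (w - c W) = W w"
          "w - c W - (z - c W) = w - z" "z - c W - (w - c W) = z - w" by (simp_all add: V_def)
        have pos: "1 / (4 * Y) > 0" using \<open>Y \<ge> 1\<close> by simp
        have half: "1 / (2 * Y) = 1 / (4 * Y) + 1 / (4 * Y)" using \<open>Y \<ge> 1\<close> by (simp add: field_simps)
        have zfar: "1 / (4 * Y) \<le> norm (z - c W - a)" if "norm a \<le> T" "V W a = 0" for a
          using zero_far[OF that] half pos by linarith
        have wfar: "1 / (4 * Y) \<le> norm (w - c W - a)" if "norm a \<le> T" "V W a = 0" for a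
        proof -
          have "norm (z - c W - a) \<le> norm (z - w) + norm (w - c W - a)"
            using norm_triangle_ineq[of "z - w" "w - c W - a"] by (simp add: algebra_simps)
          then show ?thesis
            using zero_far[OF that] half w \<open>\<rho> \<le> 1 / (4 * Y)\<close> norm_minus_commute[of w z] by linarith
        qed
        have "norm (W w) \<le> norm (W z) * exp (norm (w - z) * (X W / (1 / (4 * Y)) + 8 * (X W + 1) / T))"
          using ZH(3)[OF W small pos] zfar unfolding VW by blast
        also have "\<dots> \<le> norm (W z) * 3"
          using w by (intro mult_left_mono exponent) auto
        finally have 1: "norm (W w) \<le> 3 * norm (W z)" by simp
        have "norm (W z) \<le> norm (W w) * exp (norm (z - w) * (X W / (1 / (4 * Y)) + 8 * (X W + 1) / T))"
          using ZH(3)[OF W small(2,1) pos] wfar unfolding VW by blast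
        also have "\<dots> \<le> norm (W w) * 3"
          using w by (intro mult_left_mono exponent) (auto simp: norm_minus_commute)
        finally show ?thesis using 1 by simp
      qed
      moreover have "W z \<noteq> 0"
      proof
        assume "W z = 0"
        moreover have "norm (z - c W) \<le> T"
          using norm_triangle_ineq4[of z "c W"] c[OF W] z r \<open>R \<ge> 2\<close> by (simp add: T_def)
        ultimately have "1 / (2 * Y) \<le> norm (z - c W - (z - c W))"
          by (intro zero_far) (auto simp: V_def)
        then show False using \<open>Y \<ge> 1\<close> by simp
      qed
      ultimately show ?thesis by (simp add: steady_def)
    qed
    then show "\<exists>r\<ge>R. r \<le> 2 * R \<and>
        (\<forall>z. norm z = r \<longrightarrow> (\<forall>W\<in>Ws. steady (1 / (9 * (C * (B + 1))\<^sup>2)) z W))"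
      using r unfolding \<rho>_def Y_def by blast
  qed
qed


section \<open>Proximity function and maximum modulus\<close>

text \<open>In this form continuity and monotonicity are visible. The case \<open>x = 0\<close>
  agrees because \<open>ln 0 = 0\<close>.\<close>

lemma log_plus_eq: "0 \<le> x \<Longrightarrow> log_plus x = ln (max 1 x)"
  by (cases "x = 0") (auto simp: log_plus_def max_def not_le)

lemma log_plus_nonneg: "0 \<le> log_plus x"
  by (simp add: log_plus_def)

lemma log_plus_mono: "0 \<le> x \<Longrightarrow> x \<le> y \<Longrightarrow> log_plus x \<le> log_plus y"
  by (simp add: log_plus_eq)

lemma continuous_on_log_plus_norm:
  "continuous_on S f \<Longrightarrow> continuous_on S (\<lambda>x. log_plus (norm (f x)))"
  unfolding log_plus_eq[OF norm_ge_zero] by (intro continuous_intros) auto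

lemma continuous_on_circle:
  assumes "f holomorphic_on UNIV"
  shows "continuous_on S (\<lambda>\<theta>. f (of_real r * cis \<theta>))"
  by (rule continuous_on_compose2[OF holomorphic_on_imp_continuous_on[OF assms]])
     (auto intro!: continuous_intros)

lemma integrable_log_plus_circle:
  assumes "f holomorphic_on UNIV"
  shows "(\<lambda>\<theta>. log_plus (norm (f (of_real r * cis \<theta>)))) integrable_on {0..2 * pi}"
  by (intro integrable_continuous_interval continuous_on_log_plus_norm continuous_on_circle assms)

lemma nevanlinna_T_entire:
  assumes "f holomorphic_on UNIV"
  shows "nevanlinna_T r f = proximity r f"
proof -
  have "\<not> is_pole f z" for z using not_is_pole_holomorphic[OF _ _ assms] by simp
  then show ?thesis by (simp add: nevanlinna_T_def pole_counting_def pole_count_def)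
qed

lemma proximity_nonneg: "0 \<le> proximity r f"
proof (cases "(\<lambda>\<theta>. log_plus (norm (f (of_real r * cis \<theta>)))) integrable_on {0..2 * pi}")
  case True
  then show ?thesis unfolding proximity_def using log_plus_nonneg
    by (intro mult_nonneg_nonneg integral_nonneg) auto
qed (simp add: proximity_def not_integrable_integral)

text \<open>With empty \<open>J\<close> this passes from a maximum on the circle to the mean; with
  the coefficients as \<open>g\<close> it integrates the pointwise estimate of
  \<open>A\<^sub>m\<close>.\<close>

lemma proximity_le:
  assumes f: "f holomorphic_on UNIV" and g: "\<And>j. j \<in> J \<Longrightarrow> g j holomorphic_on UNIV"
    and "finite J"
    and le: "\<And>z. norm z = \<bar>r\<bar> \<Longrightarrow> log_plus (norm (f z)) \<le> c + (\<Sum>j\<in>J. log_plus (norm (g j z)))"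
  shows "proximity r f \<le> c + (\<Sum>j\<in>J. proximity r (g j))"
proof -
  let ?L = "\<lambda>f \<theta>. log_plus (norm (f (of_real r * cis \<theta>)))"
  have int: "?L (g j) integrable_on {0..2 * pi}" if "j \<in> J" for j
    by (rule integrable_log_plus_circle[OF g[OF that]])
  have "integral {0..2 * pi} (?L f) \<le> integral {0..2 * pi} (\<lambda>\<theta>. c + (\<Sum>j\<in>J. ?L (g j) \<theta>))"
    by (intro integral_le integrable_log_plus_circle f integrable_add integrable_const_ivl
        integrable_sum \<open>finite J\<close> int le) (simp_all add: norm_mult)
  also have "\<dots> = 2 * pi * c + (\<Sum>j\<in>J. integral {0..2 * pi} (?L (g j)))"
    by (subst integral_add) (auto intro!: integrable_sum integral_sum \<open>finite J\<close> int)
  finally have "1 / (2 * pi) * integral {0..2 * pi} (?L f) \<le>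
      1 / (2 * pi) * (2 * pi * c + (\<Sum>j\<in>J. integral {0..2 * pi} (?L (g j))))"
    by (intro mult_left_mono) auto
  then show ?thesis by (simp add: proximity_def distrib_left sum_distrib_left)
qed

section \<open>Approximation on a circle by real parts of polynomials\<close>

lemma Re_monom_mult_on_circle:
  fixes a b z :: complex
  assumes z: "norm z = r" and "l \<le> k"
  shows "Re (a * z ^ k) * Re (b * z ^ l) =
    Re (poly (monom (a * b / 2) (k + l) + monom (a * cnj b * of_real (r ^ (2 * l)) / 2) (k - l)) z)"
proof -
  \<comment> \<open>On the circle \<open>z * cnj z\<close> is the constant \<open>r\<^sup>2\<close>,
    so the lower power \<open>cnj (z ^ l)\<close> cancels against \<open>z ^ k\<close> and a
    polynomial in \<open>z\<close> remains.\<close>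
  have "z ^ k * cnj (z ^ l) = z ^ (k - l) * (z * cnj z) ^ l"
    using \<open>l \<le> k\<close> by (simp add: power_mult_distrib power_add[symmetric] mult.assoc[symmetric])
  also have "z * cnj z = of_real (r\<^sup>2)" using z by (simp add: complex_norm_square[symmetric])
  finally have "a * z ^ k * cnj (b * z ^ l) = a * cnj b * of_real (r ^ (2 * l)) * z ^ (k - l)"
    by (simp add: power_mult[symmetric] mult_ac)
  moreover have "Re x * Re y = Re (x * y / 2 + x * cnj y / 2)" for x y by (simp add: field_simps)
  ultimately have "Re (a * z ^ k) * Re (b * z ^ l) =
      Re (a * z ^ k * (b * z ^ l) / 2 + a * cnj b * of_real (r ^ (2 * l)) * z ^ (k - l) / 2)"
    by (metis (no_types))
  also have "a * z ^ k * (b * z ^ l) / 2 + a * cnj b * of_real (r ^ (2 * l)) * z ^ (k - l) / 2 =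
      poly (monom (a * b / 2) (k + l) + monom (a * cnj b * of_real (r ^ (2 * l)) / 2) (k - l)) z"
    by (simp add: poly_monom power_add)
  finally show ?thesis .
qed

text \<open>Bilinearity reduces this to monomials, where symmetry allows the smaller exponent to be
  conjugated. It is the ring property needed for Stone-Weierstrass, and it is special to the circle:
  in the plane a product of harmonic functions need not be harmonic.\<close>

lemma Re_poly_mult_on_circle:
  fixes p q :: "complex poly"
  shows "\<exists>s. \<forall>z\<in>sphere 0 r. Re (poly p z) * Re (poly q z) = Re (poly s z)"
proof -
  have "\<exists>s. \<forall>z\<in>sphere 0 r. Re (a * z ^ k) * Re (b * z ^ l) = Re (poly s z)" for a b k l
  proof (cases "l \<le> k")
    case True
    show ?thesis by (rule exI, rule ballI, rule Re_monom_mult_on_circle[OF _ True]) simp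
  next
    case False
    then have "k \<le> l" by simp
    show ?thesis
      by (rule exI, rule ballI, rule trans[OF mult.commute Re_monom_mult_on_circle[OF _ \<open>k \<le> l\<close>]]) simp
  qed
  then have "\<forall>i j. \<exists>s. \<forall>z\<in>sphere 0 r.
      Re (coeff p i * z ^ i) * Re (coeff q j * z ^ j) = Re (poly s z)" by blast
  then obtain s where s: "\<And>i j z. z \<in> sphere 0 r \<Longrightarrow>
      Re (coeff p i * z ^ i) * Re (coeff q j * z ^ j) = Re (poly (s i j) z)" by metis
  have "Re (poly p z) * Re (poly q z) = Re (poly (\<Sum>i\<le>degree p. \<Sum>j\<le>degree q. s i j) z)"
    if "z \<in> sphere 0 r" for z
    by (simp add: poly_altdef[of p] poly_altdef[of q] poly_sum sum_product s[OF that] del: Re_sum)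
       (simp add: sum_product s[OF that, symmetric])
  then show ?thesis by blast
qed

text \<open>This takes the place of the Poisson integral: the approximant is the real part of a
  polynomial and so extends harmonically into the disc.\<close>

lemma circle_approx_Re_poly:
  fixes v :: "complex \<Rightarrow> real"
  assumes "continuous_on (sphere 0 r) v" and "e > 0"
  shows "\<exists>p. \<forall>z\<in>sphere 0 r. \<bar>v z - Re (poly p z)\<bar> < e"
proof -
  let ?R = "{u. \<exists>p. \<forall>z\<in>sphere 0 r. u z = Re (poly p z)}"
  interpret function_ring_on ?R "sphere (0::complex) r"
  proof
    show "compact (sphere (0::complex) r)" by simp
    show "continuous_on (sphere 0 r) u" if u: "u \<in> ?R" for u
    proof -
      obtain p where p: "\<forall>z\<in>sphere 0 r. u z = Re (poly p z)" using u by blast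
      have "continuous_on (sphere 0 r) (\<lambda>z. Re (poly p z))" by (intro continuous_intros)
      then show ?thesis by (rule continuous_on_eq) (use p in simp)
    qed
    show "(\<lambda>x. u x + w x) \<in> ?R" if uw: "u \<in> ?R" "w \<in> ?R" for u w
    proof -
      obtain p q where "\<forall>z\<in>sphere 0 r. u z = Re (poly p z)" "\<forall>z\<in>sphere 0 r. w z = Re (poly q z)"
        using uw by blast
      then show ?thesis by (intro CollectI exI[of _ "p + q"]) simp
    qed
    show "(\<lambda>x. u x * w x) \<in> ?R" if uw: "u \<in> ?R" "w \<in> ?R" for u w
    proof -
      obtain p q where "\<forall>z\<in>sphere 0 r. u z = Re (poly p z)" "\<forall>z\<in>sphere 0 r. w z = Re (poly q z)"
        using uw by blast
      then show ?thesis using Re_poly_mult_on_circle[of r p q] by auto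
    qed
    show "(\<lambda>_. c) \<in> ?R" for c by (intro CollectI exI[of _ "[:of_real c:]"]) simp
    fix x y :: complex assume "x \<noteq> y"
    show "\<exists>u\<in>?R. u x \<noteq> u y"
    proof (cases "Re x = Re y")
      case True
      then have "Im x \<noteq> Im y" using \<open>x \<noteq> y\<close> complex_eqI by blast
      moreover have "Im \<in> ?R" by (intro CollectI exI[of _ "[:0, -\<i>:]"]) simp
      ultimately show ?thesis by blast
    next
      case False
      moreover have "Re \<in> ?R" by (intro CollectI exI[of _ "[:0, 1:]"]) simp
      ultimately show ?thesis by blast
    qed
  qed
  show ?thesis using Stone_Weierstrass_basic[OF assms] by fastforce
qed

lemma integral_poly_circle:
  assumes "r > 0"
  shows "integral {0..2 * pi} (\<lambda>\<theta>. poly p (of_real r * cis \<theta>)) = 2 * of_real pi * poly p 0"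
proof -
  have "contour_integral (circlepath 0 r) (\<lambda>u. poly p u / (u - 0)) = 2 * of_real pi * \<i> * poly p 0"
    by (rule contour_integral_unique, rule Cauchy_integral_circlepath_simple)
       (use \<open>r > 0\<close> in \<open>auto intro!: holomorphic_intros\<close>)
  moreover have "contour_integral (circlepath 0 r) (\<lambda>u. poly p u / (u - 0)) =
      integral {0..2 * pi} (\<lambda>\<theta>. \<i> * poly p (of_real r * cis \<theta>))"
    unfolding circlepath_def
    by (subst contour_integral_part_circlepath_eq) (use \<open>r > 0\<close> in \<open>simp_all add: mult_ac\<close>)
  ultimately show ?thesis by (simp add: mult.assoc)
qed

lemma norm_le_on_disc:
  fixes F :: "complex \<Rightarrow> complex"
  assumes F: "F holomorphic_on UNIV" and "r > 0"
    and "\<And>z. norm z = r \<Longrightarrow> norm (F z) \<le> B" and "norm z \<le> r"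
  shows "norm (F z) \<le> B"
proof (rule maximum_modulus_frontier[of F "cball 0 r"])
  show "F holomorphic_on interior (cball 0 r)" using F by (rule holomorphic_on_subset) simp
  show "continuous_on (closure (cball 0 r)) F"
    using holomorphic_on_imp_continuous_on[OF F] continuous_on_subset by blast
qed (use assms in \<open>auto simp: frontier_cball\<close>)

text \<open>On the circle, \<open>log_plus \<bar>f\<bar>\<close> is approximated from above by \<open>Re p\<close> for a polynomial \<open>p\<close>. The
  maximum principle for \<open>f * exp (-p)\<close> carries the majorization into the disc without any division
  by the zeros of \<open>f\<close>, and Harnack's inequality for \<open>Re p > 0\<close> compares with the mean value.\<close>

lemma log_plus_le_proximity:
  assumes f: "f holomorphic_on UNIV" and "r > 0" and z: "norm z \<le> r / 2"
  shows "log_plus (norm (f z)) \<le> 3 * proximity r f"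
proof (rule field_le_epsilon)
  fix e :: real assume "e > 0"
  \<comment> \<open>Approximating \<open>log_plus + 2 * \<epsilon>\<close> within
    \<open>\<epsilon>\<close> puts \<open>Re p\<close> between \<open>log_plus + \<epsilon>\<close>
    and \<open>log_plus + 3 * \<epsilon>\<close>. Harnack's factor 3 turns the last error into
    \<open>9 * \<epsilon> = e\<close>.\<close>
  define \<epsilon> where "\<epsilon> = e / 9"
  have "\<epsilon> > 0" using \<open>e > 0\<close> by (simp add: \<epsilon>_def)
  let ?v = "\<lambda>z. log_plus (norm (f z))"
  have "continuous_on (sphere 0 r) (\<lambda>z. ?v z + 2 * \<epsilon>)"
    by (intro continuous_intros continuous_on_log_plus_norm
        continuous_on_subset[OF holomorphic_on_imp_continuous_on[OF f]]) simp
  from circle_approx_Re_poly[OF this \<open>\<epsilon> > 0\<close>]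
  obtain p where p: "\<forall>z\<in>sphere 0 r. \<bar>?v z + 2 * \<epsilon> - Re (poly p z)\<bar> < \<epsilon>" by blast
  have lower: "?v z + \<epsilon> \<le> Re (poly p z)" and upper: "Re (poly p z) \<le> ?v z + 3 * \<epsilon>"
    if "norm z = r" for z using bspec[OF p, of z] that by auto
  have pos: "\<epsilon> \<le> Re (poly p u)" if "norm u \<le> r" for u
  proof -
    have "norm (exp (- poly p u)) \<le> exp (- \<epsilon>)"
    proof (rule norm_le_on_disc[of "\<lambda>u. exp (- poly p u)", OF _ \<open>r > 0\<close> _ that])
      show "(\<lambda>u. exp (- poly p u)) holomorphic_on UNIV" by (intro holomorphic_intros)
      fix u :: complex assume "norm u = r"
      from lower[OF this] log_plus_nonneg[of "norm (f u)"]
      show "norm (exp (- poly p u)) \<le> exp (- \<epsilon>)" by (simp add: norm_exp_eq_Re)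
    qed
    then show ?thesis by (simp add: norm_exp_eq_Re)
  qed
  have "norm (f z * exp (- poly p z)) \<le> 1"
  proof (rule norm_le_on_disc[of "\<lambda>u. f u * exp (- poly p u)", OF _ \<open>r > 0\<close>])
    show "(\<lambda>u. f u * exp (- poly p u)) holomorphic_on UNIV" by (intro holomorphic_intros f)
    show "norm z \<le> r" using z \<open>r > 0\<close> by simp
    fix u :: complex assume "norm u = r"
    have "norm (f u) \<le> exp (Re (poly p u))"
    proof (cases "f u = 0")
      case False
      have "ln (norm (f u)) \<le> Re (poly p u)"
        using lower[OF \<open>norm u = r\<close>] \<open>\<epsilon> > 0\<close> by (simp add: log_plus_def)
      with False show ?thesis by (metis exp_le_cancel_iff exp_ln zero_less_norm_iff)
    qed simp
    then show "norm (f u * exp (- poly p u)) \<le> 1"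
      by (simp only: norm_mult norm_exp_eq_Re uminus_complex.sel) (simp add: exp_minus field_simps)
  qed
  then have "norm (f z) \<le> exp (Re (poly p z))"
    by (simp only: norm_mult norm_exp_eq_Re uminus_complex.sel) (simp add: exp_minus field_simps)
  then have "max 1 (norm (f z)) \<le> exp (Re (poly p z))"
    using pos[of z] z \<open>r > 0\<close> \<open>\<epsilon> > 0\<close> by simp
  then have "ln (max 1 (norm (f z))) \<le> ln (exp (Re (poly p z)))"
    by (intro ln_mono) auto
  then have 1: "?v z \<le> Re (poly p z)" by (simp add: log_plus_eq)
  \<comment> \<open>Since \<open>Re (-p) < 0\<close> in the disc, Borel-Caratheodory applies to
    \<open>-p\<close> with \<open>A = Re p(0)\<close>, and this is Harnack's inequality with
    constant 3 on the half disc.\<close>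
  have "norm ((- poly p z) - (- poly p 0)) \<le> 2 * Re (poly p 0)"
  proof (rule Borel_Caratheodory_half[of "\<lambda>z. - poly p z", OF _ _ \<open>r > 0\<close>])
    show "(\<lambda>z. - poly p z) holomorphic_on ball 0 r" by (intro holomorphic_intros)
    show "0 < Re (poly p 0)" using pos[of 0] \<open>\<epsilon> > 0\<close> \<open>r > 0\<close> by simp
    fix u :: complex assume "norm u < r"
    with pos[of u] \<open>\<epsilon> > 0\<close> show "Re (- poly p u) < Re (- poly p 0) + Re (poly p 0)" by simp
  qed (rule z)
  then have 2: "Re (poly p z) \<le> 3 * Re (poly p 0)"
    using complex_Re_le_cmod[of "poly p z - poly p 0"] by (simp add: norm_minus_commute)
  have cont: "continuous_on {0..2 * pi} (\<lambda>\<theta>. poly p (of_real r * cis \<theta>))"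
    by (rule continuous_on_circle) (intro holomorphic_intros)
  have "2 * pi * Re (poly p 0) = Re (integral {0..2 * pi} (\<lambda>\<theta>. poly p (of_real r * cis \<theta>)))"
    by (simp add: integral_poly_circle[OF \<open>r > 0\<close>])
  also have "\<dots> = integral {0..2 * pi} (\<lambda>\<theta>. Re (poly p (of_real r * cis \<theta>)))"
    using integral_linear[OF integrable_continuous_interval[OF cont] bounded_linear_Re]
    by (simp add: o_def)
  also have "\<dots> \<le> integral {0..2 * pi} (\<lambda>\<theta>. ?v (of_real r * cis \<theta>) + 3 * \<epsilon>)"
    using \<open>r > 0\<close>
    by (intro integral_le integrable_add integrable_log_plus_circle f integrable_const_ivl
        integrable_continuous_interval continuous_intros cont upper) (simp add: norm_mult)
  also have "\<dots> = 2 * pi * (proximity r f + 3 * \<epsilon>)"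
    by (subst integral_add) (simp_all add: integrable_log_plus_circle[OF f] integrable_const_ivl proximity_def distrib_left)
  finally have 3: "Re (poly p 0) \<le> proximity r f + 3 * \<epsilon>" by simp
  show "?v z \<le> 3 * proximity r f + e" using 1 2 3 by (simp add: \<epsilon>_def)
qed

text \<open>This stands in for the monotonicity of \<open>T(r, f)\<close> in \<open>r\<close>; the
  factor 3 is invisible to the scales.\<close>

lemma proximity_le_proximity_double:
  assumes f: "f holomorphic_on UNIV" and "R > 0" and "2 * R \<le> r"
  shows "proximity R f \<le> 3 * proximity r f"
  using proximity_le[of f "{}" _ R "3 * proximity r f"] log_plus_le_proximity[OF f, of r] assms
  by simp


section \<open>Reduction of order\<close>

text \<open>Replacing \<open>j\<close> by \<open>K\<close> on the right gives one bound for a whole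
  jet; this is where \<open>\<rho> \<le> 1\<close> enters.\<close>

lemma norm_higher_deriv_le:
  assumes "q holomorphic_on cball z \<rho>" and "0 < \<rho>" "\<rho> \<le> 1" and "B \<ge> 0"
    and le: "\<And>w. norm (w - z) = \<rho> \<Longrightarrow> norm (q w) \<le> B" and "j \<le> K"
  shows "norm ((deriv ^^ j) q z) \<le> fact K * (1 / \<rho>) ^ K * B"
proof -
  have "norm ((deriv ^^ j) q z) \<le> fact j * B / \<rho> ^ j"
    using assms(1) \<open>0 < \<rho>\<close> le
    by (intro Cauchy_inequality holomorphic_on_imp_continuous_on)
       (auto intro: holomorphic_on_subset simp: norm_minus_commute)
  also have "\<dots> = fact j * (1 / \<rho>) ^ j * B" by (simp add: power_one_over field_simps)
  also have "\<dots> \<le> fact K * (1 / \<rho>) ^ K * B"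
    using \<open>j \<le> K\<close> \<open>0 < \<rho>\<close> \<open>\<rho> \<le> 1\<close> \<open>B \<ge> 0\<close>
    by (intro mult_right_mono mult_mono fact_mono power_increasing) (auto simp: field_simps)
  finally show ?thesis .
qed

lemma steady_imp_nonzero:
  assumes "steady \<rho> z W" and "norm (w - z) \<le> \<rho>"
  shows "W w \<noteq> 0"
  using assms by (force simp: steady_def)

text \<open>The constant 9 instead of 3 agrees with the estimate for \<open>1 / W\<^sup>2\<close>,
  which loses the square of 3, so that one bound serves both substitutions of a reduction
  step.\<close>

lemma steady_higher_deriv:
  assumes "W holomorphic_on UNIV" and "steady \<rho> z W" and "0 < \<rho>" "\<rho> \<le> 1" and "j \<le> K"
  shows "norm ((deriv ^^ j) W z) \<le> 9 * fact K * (1 / \<rho>) ^ K * norm (W z)"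
proof -
  have "norm ((deriv ^^ j) W z) \<le> fact K * (1 / \<rho>) ^ K * (9 * norm (W z))"
  proof (rule norm_higher_deriv_le[OF _ assms(3,4) _ _ assms(5)])
    show "W holomorphic_on cball z \<rho>" using assms(1) by (rule holomorphic_on_subset) simp
    fix w assume "norm (w - z) = \<rho>"
    then have "norm (W w) \<le> 3 * norm (W z)" using assms(2) by (simp add: steady_def)
    also have "\<dots> \<le> 9 * norm (W z)" by simp
    finally show "norm (W w) \<le> 9 * norm (W z)" .
  qed simp
  then show ?thesis by (simp add: mult_ac)
qed

lemma steady_higher_deriv_inverse_square:
  assumes W: "W holomorphic_on UNIV" and st: "steady \<rho> z W" and "0 < \<rho>" "\<rho> \<le> 1" and "j \<le> K"
  shows "norm ((deriv ^^ j) (\<lambda>w. 1 / (W w)\<^sup>2) z) \<le> 9 * fact K * (1 / \<rho>) ^ K * norm (1 / (W z)\<^sup>2)"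
proof -
  have "norm ((deriv ^^ j) (\<lambda>w. 1 / (W w)\<^sup>2) z) \<le> fact K * (1 / \<rho>) ^ K * (9 * norm (1 / (W z)\<^sup>2))"
  proof (rule norm_higher_deriv_le[OF _ assms(3,4) _ _ assms(5)])
    show "(\<lambda>w. 1 / (W w)\<^sup>2) holomorphic_on cball z \<rho>"
      using steady_imp_nonzero[OF st]
      by (intro holomorphic_intros holomorphic_on_subset[OF W])
         (auto simp: dist_norm norm_minus_commute)
    fix w assume w: "norm (w - z) = \<rho>"
    then have "norm (W z) \<le> 3 * norm (W w)" using st by (simp add: steady_def)
    then have "(norm (W z))\<^sup>2 \<le> (3 * norm (W w))\<^sup>2" by (intro power_mono) auto
    moreover have "W z \<noteq> 0" "W w \<noteq> 0" using st w steady_imp_nonzero[OF st] by (auto simp: steady_def)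
    ultimately show "norm (1 / (W w)\<^sup>2) \<le> 9 * norm (1 / (W z)\<^sup>2)"
      by (simp add: norm_divide norm_power field_simps)
  qed simp
  then show ?thesis by (simp add: mult_ac)
qed

text \<open>Leibniz's rule, with the terms collected by the derivative of \<open>u\<close>. The
  diagonal term is \<open>a s\<close> itself and all others come from \<open>a j\<close> with
  \<open>j > s\<close>, so the error only involves higher coefficients. Dividing by
  \<open>p z\<close> makes the estimate depend only on the relative size of the derivatives of
  \<open>p\<close>.\<close>

lemma jet_functional_mult:
  fixes a :: "nat \<Rightarrow> complex" and p :: "complex \<Rightarrow> complex"
  assumes "open U" "z \<in> U" and p: "p holomorphic_on U" and pz: "p z \<noteq> 0"
    and B: "\<And>i. i \<le> K \<Longrightarrow> norm ((deriv ^^ i) p z) \<le> B * norm (p z)"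
  shows "\<exists>b. (\<forall>u. u holomorphic_on U \<longrightarrow>
        (\<Sum>j\<le>K. a j * (deriv ^^ j) (\<lambda>w. u w * p w) z) = p z * (\<Sum>j\<le>K. b j * (deriv ^^ j) u z)) \<and>
      (\<forall>s\<le>K. norm (b s - a s) \<le> 2 ^ K * B * (\<Sum>j\<in>{s<..K}. norm (a j)))"
proof -
  define t where "t s j = of_nat (j choose s) * a j * (deriv ^^ (j - s)) p z / p z" for s j
  define b where "b s = (\<Sum>j\<in>{j\<in>{..K}. s \<le> j}. t s j)" for s
  have "(\<Sum>j\<le>K. a j * (deriv ^^ j) (\<lambda>w. u w * p w) z) = p z * (\<Sum>j\<le>K. b j * (deriv ^^ j) u z)"
    if u: "u holomorphic_on U" for u
  proof -
    have "(\<Sum>j\<le>K. a j * (deriv ^^ j) (\<lambda>w. u w * p w) z) =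
        (\<Sum>j\<le>K. \<Sum>i\<in>{i\<in>{..K}. i \<le> j}. p z * (t i j * (deriv ^^ i) u z))"
    proof (rule sum.cong[OF refl])
      fix j assume "j \<in> {..K}"
      then have E: "{i\<in>{..K}. i \<le> j} = {0..j}" by auto
      show "a j * (deriv ^^ j) (\<lambda>w. u w * p w) z =
          (\<Sum>i\<in>{i\<in>{..K}. i \<le> j}. p z * (t i j * (deriv ^^ i) u z))"
        unfolding E higher_deriv_mult[OF u p \<open>open U\<close> \<open>z \<in> U\<close>] sum_distrib_left
        using pz by (intro sum.cong) (auto simp: t_def)
    qed
    also have "\<dots> = (\<Sum>i\<le>K. \<Sum>j\<in>{j\<in>{..K}. i \<le> j}. p z * (t i j * (deriv ^^ i) u z))"
      by (rule sum.swap_restrict) auto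
    also have "\<dots> = p z * (\<Sum>j\<le>K. b j * (deriv ^^ j) u z)"
      by (simp add: b_def sum_distrib_left sum_distrib_right)
    finally show ?thesis .
  qed
  moreover have "norm (b s - a s) \<le> 2 ^ K * B * (\<Sum>j\<in>{s<..K}. norm (a j))" if "s \<le> K" for s
  proof -
    have "{j\<in>{..K}. s \<le> j} = insert s {s<..K}" using that by auto
    moreover have "t s s = a s" using pz by (simp add: t_def)
    ultimately have "b s - a s = (\<Sum>j\<in>{s<..K}. t s j)" by (simp add: b_def)
    also have "norm \<dots> \<le> (\<Sum>j\<in>{s<..K}. 2 ^ K * B * norm (a j))"
    proof (rule sum_norm_le)
      fix j assume j: "j \<in> {s<..K}"
      have "real (j choose s) \<le> 2 ^ j" using binomial_le_pow2[of j s] by (metis of_nat_le_iff of_nat_numeral of_nat_power)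
      also have "(2::real) ^ j \<le> 2 ^ K" using j by (intro power_increasing) auto
      finally have 1: "real (j choose s) \<le> 2 ^ K" .
      have 2: "norm ((deriv ^^ (j - s)) p z) / norm (p z) \<le> B"
      proof -
        have "j - s \<le> K" using j by auto
        then show ?thesis using B pz by (simp add: field_simps)
      qed
      have "norm (t s j) = real (j choose s) * (norm ((deriv ^^ (j - s)) p z) / norm (p z)) * norm (a j)"
        by (simp add: t_def norm_mult norm_divide)
      also have "\<dots> \<le> 2 ^ K * B * norm (a j)"
        by (intro mult_right_mono mult_mono 1 2) auto
      finally show "norm (t s j) \<le> 2 ^ K * B * norm (a j)" .
    qed
    finally show ?thesis by (simp add: sum_distrib_left)
  qed
  ultimately show ?thesis by blast
qed

text \<open>A reduction step changes \<open>a\<close> to \<open>b\<close> by the factor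
  \<open>f 0\<close> and then the shifted \<open>b\<close> to \<open>c\<close> by
  \<open>1 / (f 0)\<^sup>2\<close>. The estimate is carried back from \<open>c n\<close> to
  \<open>a (Suc n)\<close>, with the higher coefficients of \<open>c\<close> and \<open>b\<close>
  bounded successively by those of \<open>a\<close>. The result is linear in \<open>C\<close> and
  quadratic in \<open>M\<close>, so powers of \<open>1 / \<rho>\<close> stay powers.\<close>

lemma reduced_coefficient_estimate:
  fixes a b c :: "nat \<Rightarrow> complex"
  assumes "n \<le> K" and "M \<ge> 1" and "C \<ge> 0"
    and b: "\<And>s. s \<le> Suc K \<Longrightarrow> norm (b s - a s) \<le> M * (\<Sum>j\<in>{s<..Suc K}. norm (a j))"
    and c: "\<And>s. s \<le> K \<Longrightarrow> norm (c s - b (Suc s)) \<le> M * (\<Sum>j\<in>{s<..K}. norm (b (Suc j)))"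
    and cn: "norm (c n) \<le> C * (\<Sum>j\<in>{n<..K}. norm (c j))"
  shows "norm (a (Suc n)) \<le>
    (1 + 2 * real K + 4 * C * (real K)\<^sup>2) * M\<^sup>2 * (\<Sum>j\<in>{Suc n<..Suc K}. norm (a j))"
proof -
  define S where "S = (\<Sum>j\<in>{Suc n<..Suc K}. norm (a j))"
  define P where "P = (\<Sum>j\<in>{n<..K}. norm (b (Suc j)))"
  have "S \<ge> 0" "P \<ge> 0" by (simp_all add: S_def P_def sum_nonneg)
  have "M * S \<ge> 0" "M * P \<ge> 0" using \<open>S \<ge> 0\<close> \<open>P \<ge> 0\<close> \<open>M \<ge> 1\<close> by simp_all
  have M1: "x \<le> M * x" if "x \<ge> 0" for x using mult_right_mono[OF \<open>M \<ge> 1\<close> that] by simp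
  have card: "real (card {n<..K}) \<le> real K" by simp
  have b_le: "norm (b s) \<le> 2 * M * S" if s: "s \<in> {Suc n<..Suc K}" for s
  proof -
    have "norm (a s) \<le> S" unfolding S_def using s by (intro member_le_sum) auto
    moreover have "(\<Sum>j\<in>{s<..Suc K}. norm (a j)) \<le> S"
      unfolding S_def using s by (intro sum_mono2) auto
    then have "M * (\<Sum>j\<in>{s<..Suc K}. norm (a j)) \<le> M * S"
      using \<open>M \<ge> 1\<close> by (intro mult_left_mono) auto
    ultimately show ?thesis
      using b[of s] s norm_triangle_ineq2[of "b s" "a s"] M1[OF \<open>S \<ge> 0\<close>] by simp
  qed
  have "P \<le> (\<Sum>j\<in>{n<..K}. 2 * M * S)" unfolding P_def by (intro sum_mono b_le) auto
  also have "\<dots> = real (card {n<..K}) * (2 * M * S)" by simp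
  also have "\<dots> \<le> real K * (2 * M * S)" using card \<open>M * S \<ge> 0\<close> by (intro mult_right_mono) auto
  finally have P_le: "P \<le> 2 * real K * (M * S)" by simp
  have c_le: "norm (c s) \<le> 2 * (M * P)" if s: "s \<in> {n<..K}" for s
  proof -
    have "norm (b (Suc s)) \<le> P" unfolding P_def using s by (intro member_le_sum[of s _ "\<lambda>j. norm (b (Suc j))"]) auto
    moreover have "(\<Sum>j\<in>{s<..K}. norm (b (Suc j))) \<le> P"
      unfolding P_def using s by (intro sum_mono2) auto
    then have "M * (\<Sum>j\<in>{s<..K}. norm (b (Suc j))) \<le> M * P"
      using \<open>M \<ge> 1\<close> by (intro mult_left_mono) auto
    ultimately show ?thesis
      using c[of s] s norm_triangle_ineq2[of "c s" "b (Suc s)"] M1[OF \<open>P \<ge> 0\<close>] by simp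
  qed
  have "(\<Sum>j\<in>{n<..K}. norm (c j)) \<le> (\<Sum>j\<in>{n<..K}. 2 * (M * P))" by (intro sum_mono c_le)
  also have "\<dots> = real (card {n<..K}) * (2 * (M * P))" by simp
  also have "\<dots> \<le> real K * (2 * (M * P))" using card \<open>M * P \<ge> 0\<close> by (intro mult_right_mono) auto
  finally have "norm (c n) \<le> C * (real K * (2 * (M * P)))"
    using cn \<open>C \<ge> 0\<close> by (meson mult_left_mono order_trans)
  moreover have "norm (c n - b (Suc n)) \<le> M * P" using c[of n] \<open>n \<le> K\<close> by (simp add: P_def)
  moreover have "norm (b (Suc n) - a (Suc n)) \<le> M * S" using b[of "Suc n"] \<open>n \<le> K\<close> by (simp add: S_def)
  moreover have "norm (a (Suc n)) \<le> norm (b (Suc n) - a (Suc n)) + norm (c n - b (Suc n)) + norm (c n)"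
    using norm_triangle_ineq4[of "b (Suc n)" "b (Suc n) - a (Suc n)"]
      norm_triangle_ineq4[of "c n" "c n - b (Suc n)"] by simp
  ultimately have "norm (a (Suc n)) \<le> M * S + (1 + 2 * C * real K) * (M * P)"
    by (simp add: algebra_simps)
  also have "\<dots> \<le> M * (M * S) + (1 + 2 * C * real K) * (M * (2 * real K * (M * S)))"
    using P_le \<open>M \<ge> 1\<close> \<open>C \<ge> 0\<close> M1[OF \<open>M * S \<ge> 0\<close>] by (intro add_mono mult_left_mono) auto
  also have "\<dots> = (1 + 2 * real K + 4 * C * (real K)\<^sup>2) * M\<^sup>2 * S"
    by (simp add: power2_eq_square algebra_simps)
  finally show ?thesis by (simp add: S_def)
qed

text \<open>The relation says that \<open>g / f 0\<close> has derivative 0 where \<open>f 0\<close>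
  does not vanish. Hence \<open>g\<close> is a multiple of \<open>f 0\<close> on a disc, by the
  identity theorem everywhere, and this is a linear relation among the original functions.\<close>

lemma independent_reduction:
  fixes f :: "nat \<Rightarrow> complex \<Rightarrow> complex"
  assumes holo: "\<And>i. i \<le> Suc n \<Longrightarrow> f i holomorphic_on UNIV"
    and indep: "\<And>c. (\<And>z. (\<Sum>i\<le>Suc n. c i * f i z) = 0) \<Longrightarrow> \<forall>i\<le>Suc n. c i = 0"
    and zero: "\<And>z. (\<Sum>i\<le>n. c i * (f 0 z * deriv (f (Suc i)) z - f (Suc i) z * deriv (f 0) z)) = 0"
  shows "\<forall>i\<le>n. c i = 0"
proof -
  define g where "g z = (\<Sum>i\<le>n. c i * f (Suc i) z)" for z
  have g: "g holomorphic_on UNIV" unfolding g_def by (intro holomorphic_intros holo) auto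
  have f0: "f 0 holomorphic_on UNIV" using holo by simp
  have fd: "f i field_differentiable at z" if "i \<le> Suc n" for i z
    using holomorphic_on_imp_differentiable_at[OF holo[OF that]] by simp
  have "\<exists>z0. f 0 z0 \<noteq> 0"
  proof (rule ccontr)
    assume "\<not> ?thesis"
    then have "(\<Sum>i\<le>Suc n. (if i = 0 then 1 else 0) * f i z) = 0" for z
      by (intro sum.neutral) auto
    from indep[OF this, rule_format, of 0] show False by simp
  qed
  then obtain z0 where "f 0 z0 \<noteq> 0" by blast
  then obtain e where "e > 0" and e: "\<And>z. z \<in> ball z0 e \<Longrightarrow> f 0 z \<noteq> 0"
    using continuous_at_avoid[of z0 "f 0" 0] fd[of 0 z0] field_differentiable_imp_continuous_at
    by (auto simp: dist_commute)
  have "((\<lambda>z. g z / f 0 z) has_field_derivative 0) (at z within ball z0 e)" if z: "z \<in> ball z0 e" for z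
  proof -
    have dg: "(g has_field_derivative (\<Sum>i\<le>n. c i * deriv (f (Suc i)) z)) (at z)"
      unfolding g_def
      by (intro derivative_eq_intros DERIV_sum DERIV_cmult)
         (auto simp: DERIV_deriv_iff_field_differentiable fd)
    have d0: "(f 0 has_field_derivative deriv (f 0) z) (at z)"
      by (simp add: DERIV_deriv_iff_field_differentiable fd)
    have "((\<lambda>z. g z / f 0 z) has_field_derivative
        ((\<Sum>i\<le>n. c i * deriv (f (Suc i)) z) * f 0 z - g z * deriv (f 0) z) / (f 0 z * f 0 z)) (at z)"
      by (rule DERIV_divide[OF dg d0 e[OF z]])
    moreover have "(\<Sum>i\<le>n. c i * deriv (f (Suc i)) z) * f 0 z - g z * deriv (f 0) z =
        (\<Sum>i\<le>n. c i * (f 0 z * deriv (f (Suc i)) z - f (Suc i) z * deriv (f 0) z))"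
      by (simp add: g_def sum_distrib_left sum_distrib_right sum_subtractf algebra_simps)
    ultimately show ?thesis using zero[of z] by (simp add: has_field_derivative_at_within)
  qed
  then obtain k where k: "\<And>z. z \<in> ball z0 e \<Longrightarrow> g z / f 0 z = k"
    using has_field_derivative_zero_constant[of "ball z0 e" "\<lambda>z. g z / f 0 z"] by auto
  have eq: "g z = k * f 0 z" for z
  proof (rule analytic_continuation_open[of "ball z0 e" UNIV g "\<lambda>z. k * f 0 z"])
    show "(\<lambda>z. k * f 0 z) holomorphic_on UNIV" by (intro holomorphic_intros f0)
    show "g w = k * f 0 w" if "w \<in> ball z0 e" for w using k[OF that] e[OF that] by (simp add: field_simps)
  qed (use g \<open>e > 0\<close> in auto)
  define d where "d i = (case i of 0 \<Rightarrow> - k | Suc i \<Rightarrow> c i)" for i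
  have "(\<Sum>i\<le>Suc n. d i * f i z) = 0" for z
    using eq[of z] by (simp add: sum.atMost_Suc_shift d_def g_def del: sum.atMost_Suc)
  from indep[OF this] have "\<forall>i\<le>Suc n. d i = 0" .
  then show ?thesis by (force simp: d_def dest: spec[of _ "Suc _"])
qed

text \<open>Here \<open>a\<close> is an arbitrary vector annihilating the jets at the single point
  \<open>z\<close>, not the values of given coefficient functions; this is what lets the induction
  pass to the transformed vector \<open>c\<close>. The constants \<open>C\<close> and
  \<open>N\<close> come before \<open>\<rho>\<close> and \<open>z\<close>, hence serve a whole
  circle of any radius.\<close>

definition jet_bound ::
    "(complex \<Rightarrow> complex) set \<Rightarrow> (nat \<Rightarrow> complex \<Rightarrow> complex) \<Rightarrow> nat \<Rightarrow> nat \<Rightarrow> bool" where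
  "jet_bound Ws f n K \<longleftrightarrow> (\<exists>C\<ge>1. \<exists>N. \<forall>\<rho> z a. 0 < \<rho> \<longrightarrow> \<rho> \<le> 1 \<longrightarrow> (\<forall>W\<in>Ws. steady \<rho> z W) \<longrightarrow>
     (\<forall>i\<le>n. (\<Sum>j\<le>K. a j * (deriv ^^ j) (f i) z) = 0) \<longrightarrow>
     norm (a n) \<le> C * (1 / \<rho>) ^ N * (\<Sum>j\<in>{n<..K}. norm (a j)))"

lemma jet_boundI:
  assumes "C \<ge> 1"
    and "\<And>\<rho> z a. 0 < \<rho> \<Longrightarrow> \<rho> \<le> 1 \<Longrightarrow> (\<And>W. W \<in> Ws \<Longrightarrow> steady \<rho> z W) \<Longrightarrow>
      (\<And>i. i \<le> n \<Longrightarrow> (\<Sum>j\<le>K. a j * (deriv ^^ j) (f i) z) = 0) \<Longrightarrow>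
      norm (a n) \<le> C * (1 / \<rho>) ^ N * (\<Sum>j\<in>{n<..K}. norm (a j))"
  shows "jet_bound Ws f n K"
  unfolding jet_bound_def
proof (rule exI[of _ C], rule conjI[OF assms(1)], rule exI[of _ N], intro allI impI)
  fix \<rho> z and a :: "nat \<Rightarrow> complex"
  assume "0 < \<rho>" "\<rho> \<le> 1" "\<forall>W\<in>Ws. steady \<rho> z W" "\<forall>i\<le>n. (\<Sum>j\<le>K. a j * (deriv ^^ j) (f i) z) = 0"
  then show "norm (a n) \<le> C * (1 / \<rho>) ^ N * (\<Sum>j\<in>{n<..K}. norm (a j))"
    by (intro assms(2)[of \<rho> z a]) simp_all
qed

text \<open>Reduction of order, carried out on the jets at a single point: writing \<open>f\<^sub>i = f\<^sub>0 * g\<^sub>i\<close>, the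
  functional with coefficients \<open>a\<close> becomes one in \<open>g\<^sub>i' = F\<^sub>i / f\<^sub>0\<^sup>2\<close>, where the numerators \<open>F\<^sub>i\<close> are
  again entire. The coefficients change by a unipotent triangular substitution. Steadiness replaces
  the lemma on the logarithmic derivative.\<close>

lemma reduction_of_order:
  fixes f :: "nat \<Rightarrow> complex \<Rightarrow> complex"
  assumes D_holo: "\<And>g. g \<in> D \<Longrightarrow> g holomorphic_on UNIV"
    and D_closed: "\<And>g h. g \<in> D \<Longrightarrow> h \<in> D \<Longrightarrow> (\<lambda>z. g z * deriv h z - h z * deriv g z) \<in> D"
    and "\<And>i. i \<le> n \<Longrightarrow> f i \<in> D"
    and "\<And>c. (\<And>z. (\<Sum>i\<le>n. c i * f i z) = 0) \<Longrightarrow> \<forall>i\<le>n. c i = 0"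
  shows "\<exists>Ws. finite Ws \<and> Ws \<subseteq> D \<and> (\<forall>W\<in>Ws. \<exists>z. W z \<noteq> 0) \<and>
    (\<forall>K\<ge>n. jet_bound Ws f n K)"
  using assms(3,4)
proof (induction n arbitrary: f)
  case 0
  have f0: "f 0 \<in> D" "f 0 holomorphic_on UNIV" using "0.prems"(1) D_holo by auto
  have nz: "\<exists>z. f 0 z \<noteq> 0" using "0.prems"(2)[of "\<lambda>_. 1"] by auto
  have est: "norm (a 0) \<le> (9 * fact K) * (1 / \<rho>) ^ K * (\<Sum>j\<in>{0<..K}. norm (a j))"
    if \<rho>: "0 < \<rho>" "\<rho> \<le> 1" and st: "steady \<rho> z (f 0)"
      and eq: "(\<Sum>j\<le>K. a j * (deriv ^^ j) (f 0) z) = 0" for K \<rho> z and a :: "nat \<Rightarrow> complex"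
  proof -
    have nz: "f 0 z \<noteq> 0" using st by (simp add: steady_def)
    \<comment> \<open>With one function left, the relation is divided by \<open>f 0 z\<close>, and
      steadiness bounds the quotients \<open>(deriv ^^ j) (f 0) z / f 0 z\<close>.\<close>
    have "{..K} = insert 0 {0<..K}" by auto
    then have "a 0 * f 0 z = - (\<Sum>j\<in>{0<..K}. a j * (deriv ^^ j) (f 0) z)"
      using eq by (simp add: eq_neg_iff_add_eq_0)
    then have "norm (a 0) * norm (f 0 z) = norm (\<Sum>j\<in>{0<..K}. a j * (deriv ^^ j) (f 0) z)"
      by (metis norm_minus_cancel norm_mult)
    also have "\<dots> \<le> (\<Sum>j\<in>{0<..K}. norm (a j) * (9 * fact K * (1 / \<rho>) ^ K * norm (f 0 z)))"
      using steady_higher_deriv[OF f0(2) st \<rho>]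
      by (intro sum_norm_le) (auto simp: norm_mult intro!: mult_left_mono)
    also have "\<dots> = (9 * fact K * (1 / \<rho>) ^ K * (\<Sum>j\<in>{0<..K}. norm (a j))) * norm (f 0 z)"
      by (simp add: sum_distrib_left sum_distrib_right mult_ac)
    finally show ?thesis using nz by (simp only: mult_le_cancel_right) simp
  qed
  show ?case
  proof (rule exI[of _ "{f 0}"], intro conjI allI impI)
    fix K :: nat
    have C: "(1::real) \<le> 9 * fact K"
      using fact_ge_1[of K, where ?'a = real] by linarith
    show "jet_bound {f 0} f 0 K"
      by (rule jet_boundI[where N = K, OF C], rule est) simp_all
  qed (use f0(1) nz in auto)
next
  case (Suc n)
  have f_holo: "f i holomorphic_on UNIV" if "i \<le> Suc n" for i using Suc.prems(1) D_holo that by blast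
  define F where "F i z = f 0 z * deriv (f (Suc i)) z - f (Suc i) z * deriv (f 0) z" for i z
  have FD: "F i \<in> D" if "i \<le> n" for i
    unfolding F_def using that by (intro D_closed Suc.prems(1)) auto
  have F_indep: "\<forall>i\<le>n. c i = 0" if "\<And>z. (\<Sum>i\<le>n. c i * F i z) = 0" for c
    by (rule independent_reduction[OF f_holo Suc.prems(2)]) (use that in \<open>auto simp: F_def\<close>)
  obtain Ws where Ws: "finite Ws" "Ws \<subseteq> D" "\<forall>W\<in>Ws. \<exists>z. W z \<noteq> 0"
    and est: "\<forall>K\<ge>n. jet_bound Ws F n K"
  proof (rule exE[OF Suc.IH[of F]])
    show "F i \<in> D" if "i \<le> n" for i using that by (rule FD)
    show "\<forall>i\<le>n. c i = 0" if "\<And>z. (\<Sum>i\<le>n. c i * F i z) = 0" for c using that by (rule F_indep)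
  qed (elim conjE, rule that)
  have f0: "f 0 holomorphic_on UNIV" using f_holo by simp
  have f0_nz: "\<exists>z. f 0 z \<noteq> 0"
  proof (rule ccontr)
    assume "\<not> ?thesis"
    then have "(\<Sum>i\<le>Suc n. (if i = 0 then 1 else 0) * f i z) = 0" for z
      by (intro sum.neutral) auto
    from Suc.prems(2)[OF this, rule_format, of 0] show False by simp
  qed
  have main: "jet_bound (insert (f 0) Ws) f (Suc n) (Suc K)" if "n \<le> K" for K
  proof -
    have "jet_bound Ws F n K" using est that by simp
    then obtain C N where "C \<ge> 1" and CN: "\<forall>\<rho> z a. 0 < \<rho> \<longrightarrow> \<rho> \<le> 1 \<longrightarrow>
      (\<forall>W\<in>Ws. steady \<rho> z W) \<longrightarrow> (\<forall>i\<le>n. (\<Sum>j\<le>K. a j * (deriv ^^ j) (F i) z) = 0) \<longrightarrow>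
      norm (a n) \<le> C * (1 / \<rho>) ^ N * (\<Sum>j\<in>{n<..K}. norm (a j))"
      unfolding jet_bound_def by (elim exE conjE) (rule that)
    define M0 :: real where "M0 = 2 ^ Suc K * (9 * fact (Suc K))"
    define C' where "C' = (1 + 2 * real K + 4 * C * (real K)\<^sup>2) * M0\<^sup>2"
    have "(1::real) * (9 * 1) \<le> 2 ^ Suc K * (9 * fact (Suc K))"
      by (intro mult_mono fact_ge_1 one_le_power) auto
    then have "M0 \<ge> 1" unfolding M0_def by linarith
    have "1 * 1 \<le> C'"
      unfolding C'_def using \<open>C \<ge> 1\<close> \<open>M0 \<ge> 1\<close> by (intro mult_mono one_le_power) auto
    then have "1 \<le> C'" by simp
    then show ?thesis
    proof (rule jet_boundI)
      fix \<rho> z and a :: "nat \<Rightarrow> complex"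
      assume \<rho>: "0 < \<rho>" "\<rho> \<le> 1" and st: "\<And>W. W \<in> insert (f 0) Ws \<Longrightarrow> steady \<rho> z W"
        and eq: "\<And>i. i \<le> Suc n \<Longrightarrow> (\<Sum>j\<le>Suc K. a j * (deriv ^^ j) (f i) z) = 0"
      define U where "U = ball z \<rho>"
      have U: "open U" "z \<in> U" using \<rho> by (auto simp: U_def)
      have st0: "steady \<rho> z (f 0)" using st by simp
      have nz: "f 0 w \<noteq> 0" if "w \<in> U" for w
        using that by (intro steady_imp_nonzero[OF st0]) (simp add: U_def dist_norm norm_minus_commute)
      have fU: "f i holomorphic_on U" if "i \<le> Suc n" for i
        using f_holo[OF that] by (rule holomorphic_on_subset) simp
      define q where "q w = 1 / (f 0 w)\<^sup>2" for w
      have qU: "q holomorphic_on U" unfolding q_def by (intro holomorphic_intros fU) (use nz in auto)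
      have qz: "q z \<noteq> 0" using nz U by (simp add: q_def)
      define B where "B = 9 * fact (Suc K) * (1 / \<rho>) ^ Suc K"
      define M where "M = M0 * (1 / \<rho>) ^ Suc K"
      have MB: "2 ^ Suc K * B = M" by (simp add: M_def M0_def B_def)
      have "1 \<le> (1 / \<rho>) ^ Suc K" using \<rho> by (intro one_le_power) simp
      from mult_mono[OF \<open>M0 \<ge> 1\<close> this] have "M \<ge> 1"
        using \<open>M0 \<ge> 1\<close> by (simp add: M_def del: power_Suc)
      obtain b where b_eq: "\<And>u. u holomorphic_on U \<Longrightarrow>
          (\<Sum>j\<le>Suc K. a j * (deriv ^^ j) (\<lambda>w. u w * f 0 w) z) = f 0 z * (\<Sum>j\<le>Suc K. b j * (deriv ^^ j) u z)"
        and b_le: "\<And>s. s \<le> Suc K \<Longrightarrow> norm (b s - a s) \<le> M * (\<Sum>j\<in>{s<..Suc K}. norm (a j))"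
        using jet_functional_mult[OF U fU[of 0] nz[OF U(2)], of "Suc K" B a]
          steady_higher_deriv[OF f0 st0 \<rho>, of _ "Suc K"] unfolding MB by (auto simp: B_def)
      obtain c where c_eq: "\<And>u. u holomorphic_on U \<Longrightarrow>
          (\<Sum>j\<le>K. b (Suc j) * (deriv ^^ j) (\<lambda>w. u w * q w) z) = q z * (\<Sum>j\<le>K. c j * (deriv ^^ j) u z)"
        and c_le0: "\<And>s. s \<le> K \<Longrightarrow> norm (c s - b (Suc s)) \<le> 2 ^ K * B * (\<Sum>j\<in>{s<..K}. norm (b (Suc j)))"
        using jet_functional_mult[OF U qU qz, of K B "\<lambda>j. b (Suc j)"]
          steady_higher_deriv_inverse_square[OF f0 st0 \<rho>, of _ "Suc K"]
        by (auto simp: B_def q_def)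
      have c_le: "norm (c s - b (Suc s)) \<le> M * (\<Sum>j\<in>{s<..K}. norm (b (Suc j)))" if "s \<le> K" for s
      proof -
        have "0 \<le> B" using \<rho> by (simp add: B_def)
        then have "2 ^ K * B \<le> M" unfolding MB[symmetric] by (intro mult_right_mono) auto
        then show ?thesis
          using c_le0[OF that] by (meson mult_right_mono norm_ge_zero order_trans sum_nonneg)
      qed
      \<comment> \<open>The test function 1 corresponds to \<open>f 0\<close>, on which the
        functional vanishes. So the new functional has no term of order 0 and acts on the derivative
        of \<open>g\<close> alone.\<close>
      have "b 0 = 0"
      proof -
        have "f 0 z * (\<Sum>j\<le>Suc K. b j * (deriv ^^ j) (\<lambda>_. 1) z) = 0"
          using b_eq[of "\<lambda>_. 1"] eq by simp
        then have "(\<Sum>j\<le>Suc K. b j * (deriv ^^ j) (\<lambda>_. 1) z) = 0" using nz[OF U(2)] by simp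
        also have "(\<Sum>j\<le>Suc K. b j * (deriv ^^ j) (\<lambda>_. 1) z) = (\<Sum>j\<le>Suc K. if j = 0 then b 0 else 0)"
          by (intro sum.cong) (auto simp: higher_deriv_const)
        finally show ?thesis by simp
      qed
      have "(\<Sum>j\<le>K. c j * (deriv ^^ j) (F i) z) = 0" if i: "i \<le> n" for i
      proof -
        define g where "g w = f (Suc i) w / f 0 w" for w
        have gU: "g holomorphic_on U" unfolding g_def using i nz by (intro holomorphic_intros fU) auto
        have FU: "F i holomorphic_on U" using D_holo[OF FD[OF i]] by (rule holomorphic_on_subset) simp
        have dg: "deriv g w = F i w * q w" if w: "w \<in> U" for w
        proof -
          have fd: "(f j has_field_derivative deriv (f j) w) (at w)" if "j \<le> Suc n" for j
            using holomorphic_derivI[OF fU[OF that] U(1) w] .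
          have "(g has_field_derivative
              (deriv (f (Suc i)) w * f 0 w - f (Suc i) w * deriv (f 0) w) / (f 0 w * f 0 w)) (at w)"
            unfolding g_def using i by (intro DERIV_divide fd nz w) auto
          then show ?thesis
            by (simp add: DERIV_imp_deriv F_def q_def power2_eq_square mult_ac)
        qed
        have "(\<Sum>j\<le>Suc K. a j * (deriv ^^ j) (\<lambda>w. g w * f 0 w) z) =
            (\<Sum>j\<le>Suc K. a j * (deriv ^^ j) (f (Suc i)) z)"
        proof (intro sum.cong arg_cong2[of _ _ _ _ "(*)"] refl)
          fix j
          show "(deriv ^^ j) (\<lambda>w. g w * f 0 w) z = (deriv ^^ j) (f (Suc i)) z"
          proof (rule higher_deriv_transform_within_open[OF _ _ U])
            show "(\<lambda>w. g w * f 0 w) holomorphic_on U" by (intro holomorphic_intros gU fU) simp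
            show "f (Suc i) holomorphic_on U" using i by (intro fU) simp
            show "g w * f 0 w = f (Suc i) w" if "w \<in> U" for w using nz[OF that] by (simp add: g_def)
          qed
        qed
        then have "f 0 z * (\<Sum>j\<le>Suc K. b j * (deriv ^^ j) g z) = 0"
          using b_eq[OF gU] eq i by simp
        then have "(\<Sum>j\<le>Suc K. b j * (deriv ^^ j) g z) = 0" using nz[OF U(2)] by simp
        then have "(\<Sum>j\<le>K. b (Suc j) * (deriv ^^ Suc j) g z) = 0"
          using \<open>b 0 = 0\<close> by (simp add: sum.atMost_Suc_shift del: sum.atMost_Suc funpow.simps)
        also have "(\<Sum>j\<le>K. b (Suc j) * (deriv ^^ Suc j) g z) =
            (\<Sum>j\<le>K. b (Suc j) * (deriv ^^ j) (\<lambda>w. F i w * q w) z)"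
        proof (intro sum.cong arg_cong2[of _ _ _ _ "(*)"] refl)
          fix j
          have "(deriv ^^ j) (deriv g) z = (deriv ^^ j) (\<lambda>w. F i w * q w) z"
            by (rule higher_deriv_transform_within_open[OF _ _ U dg])
               (auto intro!: holomorphic_intros holomorphic_deriv gU FU qU U)
          then show "(deriv ^^ Suc j) g z = (deriv ^^ j) (\<lambda>w. F i w * q w) z"
            by (simp add: funpow_Suc_right del: funpow.simps)
        qed
        finally show ?thesis using c_eq[OF FU] qz by simp
      qed
      then have "norm (c n) \<le> C * (1 / \<rho>) ^ N * (\<Sum>j\<in>{n<..K}. norm (c j))"
        using \<rho> st by (intro CN[rule_format]) auto
      then have "norm (a (Suc n)) \<le>
          (1 + 2 * real K + 4 * (C * (1 / \<rho>) ^ N) * (real K)\<^sup>2) * M\<^sup>2 * (\<Sum>j\<in>{Suc n<..Suc K}. norm (a j))"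
        using \<open>C \<ge> 1\<close> \<rho>
        by (intro reduced_coefficient_estimate[OF \<open>n \<le> K\<close> \<open>M \<ge> 1\<close> _ b_le c_le]) auto
      also have "\<dots> \<le> ((1 + 2 * real K + 4 * C * (real K)\<^sup>2) * (1 / \<rho>) ^ N) * M\<^sup>2 *
          (\<Sum>j\<in>{Suc n<..Suc K}. norm (a j))"
      proof (intro mult_right_mono)
        have "1 \<le> (1 / \<rho>) ^ N" using \<rho> by (intro one_le_power) simp
        then have "(1 + 2 * real K) * 1 \<le> (1 + 2 * real K) * (1 / \<rho>) ^ N"
          by (intro mult_left_mono) auto
        then show "1 + 2 * real K + 4 * (C * (1 / \<rho>) ^ N) * (real K)\<^sup>2 \<le>
            (1 + 2 * real K + 4 * C * (real K)\<^sup>2) * (1 / \<rho>) ^ N"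
          by (simp add: algebra_simps)
      qed (auto intro: sum_nonneg)
      \<comment> \<open>The factor \<open>M\<^sup>2\<close> raises the exponent of
        \<open>1 / \<rho>\<close> by \<open>2 * Suc K\<close>, an amount independent of the point
        and of \<open>\<rho>\<close>.\<close>
      also have "\<dots> = C' * (1 / \<rho>) ^ (N + 2 * Suc K) * (\<Sum>j\<in>{Suc n<..Suc K}. norm (a j))"
        by (simp only: C'_def M_def power_mult_distrib power_even_eq power_add)
           (simp only: mult_ac)
      finally show "norm (a (Suc n)) \<le>
          C' * (1 / \<rho>) ^ (N + 2 * Suc K) * (\<Sum>j\<in>{Suc n<..Suc K}. norm (a j))" .
    qed
  qed
  have "\<forall>K\<ge>Suc n. jet_bound (insert (f 0) Ws) f (Suc n) K"
    using main by (metis Suc_le_D Suc_le_mono)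
  then show ?case
    using Ws f0_nz Suc.prems(1)[of 0] by (intro exI[of _ "insert (f 0) Ws"] conjI) auto
qed


section \<open>Bounding a coefficient\<close>

text \<open>This is the instance of the set \<open>D\<close> in \<open>reduction_of_order\<close>,
  with \<open>\<Phi>\<close> built from the maximum moduli of the solutions. Constants are allowed
  both outside and inside \<open>\<Phi>\<close> because products multiply the exponent and
  derivatives enlarge the radius.\<close>

definition growth_class :: "(real \<Rightarrow> real) \<Rightarrow> (complex \<Rightarrow> complex) set" where
  "growth_class \<Phi> = {f. f holomorphic_on UNIV \<and>
     (\<exists>C\<ge>1. \<forall>r\<ge>1. \<forall>z. norm z \<le> r \<longrightarrow> norm (f z) \<le> exp (C * \<Phi> (C * r)))}"

lemma growth_bound_mono:
  fixes \<Phi> :: "real \<Rightarrow> real"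
  assumes \<Phi>: "\<And>x. 1 \<le> x \<Longrightarrow> 1 \<le> \<Phi> x" "\<And>x y. 1 \<le> x \<Longrightarrow> x \<le> y \<Longrightarrow> \<Phi> x \<le> \<Phi> y"
    and C: "1 \<le> C" "C \<le> C'" "1 \<le> r" "r \<le> r'"
  shows "exp (C * \<Phi> (C * r)) \<le> exp (C' * \<Phi> (C' * r'))"
proof -
  have "1 * 1 \<le> C * r" using C by (intro mult_mono) auto
  moreover have "C * r \<le> C' * r'" using C by (intro mult_mono) auto
  ultimately have "\<Phi> (C * r) \<le> \<Phi> (C' * r')" "0 \<le> \<Phi> (C * r)" using \<Phi>(1)[of "C * r"] \<Phi>(2) by auto
  then show ?thesis using C by (auto intro: mult_mono)
qed

text \<open>Cauchy's inequality on a unit disc bounds the derivatives at radius \<open>r\<close> by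
  the functions at \<open>2 * r\<close>. Of the new constant \<open>3 * C\<close>, two parts are for
  the two factors of a product, and the third absorbs the sum of two products.\<close>

lemma growth_class_closed:
  assumes \<Phi>: "\<And>x. 1 \<le> x \<Longrightarrow> 1 \<le> \<Phi> x" "\<And>x y. 1 \<le> x \<Longrightarrow> x \<le> y \<Longrightarrow> \<Phi> x \<le> \<Phi> y"
    and f: "f \<in> growth_class \<Phi>" and g: "g \<in> growth_class \<Phi>"
  shows "(\<lambda>z. f z * deriv g z - g z * deriv f z) \<in> growth_class \<Phi>"
proof -
  obtain Cf where Cf: "Cf \<ge> 1" "\<And>r z. r \<ge> 1 \<Longrightarrow> norm z \<le> r \<Longrightarrow> norm (f z) \<le> exp (Cf * \<Phi> (Cf * r))"
    using f unfolding growth_class_def by blast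
  obtain Cg where Cg: "Cg \<ge> 1" "\<And>r z. r \<ge> 1 \<Longrightarrow> norm z \<le> r \<Longrightarrow> norm (g z) \<le> exp (Cg * \<Phi> (Cg * r))"
    using g unfolding growth_class_def by blast
  have holo: "f holomorphic_on UNIV" "g holomorphic_on UNIV"
    using f g by (auto simp: growth_class_def)
  define C where "C = max Cf Cg"
  have "C \<ge> 1" "Cf \<le> C" "Cg \<le> C" using Cf(1) by (auto simp: C_def)
  define E where "E r = exp (C * \<Phi> (C * (2 * r)))" for r
  have bd: "norm (f z) \<le> E r" "norm (g z) \<le> E r" if "norm z \<le> 2 * r" "r \<ge> 1" for z r
  proof -
    have mono: "exp (c * \<Phi> (c * (2 * r))) \<le> E r" if "1 \<le> c" "c \<le> C" for c
      unfolding E_def by (rule growth_bound_mono[of \<Phi>]) (use \<Phi> that \<open>r \<ge> 1\<close> in auto)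
    show "norm (f z) \<le> E r"
      by (rule order_trans[OF Cf(2) mono]) (use that Cf(1) \<open>Cf \<le> C\<close> in auto)
    show "norm (g z) \<le> E r"
      by (rule order_trans[OF Cg(2) mono]) (use that Cg(1) \<open>Cg \<le> C\<close> in auto)
  qed
  have deriv_bd: "norm (deriv h z) \<le> E r"
    if h: "h holomorphic_on UNIV" "\<And>z. norm z \<le> 2 * r \<Longrightarrow> norm (h z) \<le> E r" and z: "norm z \<le> r" "r \<ge> 1" for h z r
  proof -
    have "norm ((deriv ^^ 1) h z) \<le> fact 1 * (1 / 1) ^ 1 * E r"
    proof (rule norm_higher_deriv_le)
      show "h holomorphic_on cball z 1" using h(1) by (rule holomorphic_on_subset) simp
      fix w assume "norm (w - z) = 1"
      then show "norm (h w) \<le> E r"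
        using norm_triangle_ineq[of "w - z" z] z by (intro h(2)) simp
    qed (auto simp: E_def)
    then show ?thesis by simp
  qed
  have "norm (f z * deriv g z - g z * deriv f z) \<le> exp (3 * C * \<Phi> (3 * C * r))"
    if "r \<ge> 1" "norm z \<le> r" for r z
  proof -
    have "norm (f z * deriv g z - g z * deriv f z) \<le> norm (f z) * norm (deriv g z) + norm (g z) * norm (deriv f z)"
      using norm_triangle_ineq4 by (metis norm_mult)
    also have "\<dots> \<le> E r * E r + E r * E r"
      using that holo bd by (intro add_mono mult_mono deriv_bd) (auto simp: E_def)
    also have "\<dots> = 2 * (E r * E r)" by simp
    also have "\<dots> \<le> exp 1 * (E r * E r)"
      using exp_ge_add_one_self[of "1::real"] by (intro mult_right_mono) (auto simp: E_def)
    also have "\<dots> = exp (1 + 2 * (C * \<Phi> (C * (2 * r))))" by (simp add: E_def exp_add[symmetric])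
    also have "\<dots> \<le> exp (3 * C * \<Phi> (3 * C * r))"
    proof (intro iffD2[OF exp_le_cancel_iff])
      have "1 * 1 \<le> C * (2 * r)" using \<open>C \<ge> 1\<close> that by (intro mult_mono) auto
      moreover have "C * (2 * r) \<le> 3 * C * r" using \<open>C \<ge> 1\<close> that by simp
      ultimately have "\<Phi> (C * (2 * r)) \<le> \<Phi> (3 * C * r)" "1 \<le> \<Phi> (C * (2 * r))" using \<Phi> by auto
      then have "C * \<Phi> (C * (2 * r)) \<le> C * \<Phi> (3 * C * r)" "1 * 1 \<le> C * \<Phi> (C * (2 * r))"
        using \<open>C \<ge> 1\<close> mult_mono[of 1 C 1 "\<Phi> (C * (2 * r))"] by auto
      then show "1 + 2 * (C * \<Phi> (C * (2 * r))) \<le> 3 * C * \<Phi> (3 * C * r)" by linarith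
    qed
    finally show ?thesis .
  qed
  moreover have "3 * C \<ge> 1" using \<open>C \<ge> 1\<close> by simp
  moreover have "(\<lambda>z. f z * deriv g z - g z * deriv f z) holomorphic_on UNIV"
    using holo by (intro holomorphic_intros holomorphic_deriv) auto
  ultimately show ?thesis unfolding growth_class_def by blast
qed

text \<open>Every \<open>x j\<close> is at most \<open>exp S\<close> for the sum \<open>S\<close> of
  the \<open>log_plus (x j)\<close>. The summand 1 next to \<open>card J\<close> keeps the argument
  of the logarithm at least 1 when \<open>J\<close> is empty.\<close>

lemma log_plus_sum_le:
  fixes x :: "'a \<Rightarrow> real"
  assumes "finite J" and "c \<ge> 1" and x: "\<And>j. j \<in> J \<Longrightarrow> 0 \<le> x j"
  shows "log_plus (c * (\<Sum>j\<in>J. x j)) \<le> ln (c * (real (card J) + 1)) + (\<Sum>j\<in>J. log_plus (x j))"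
proof -
  define S where "S = (\<Sum>j\<in>J. log_plus (x j))"
  have "S \<ge> 0" by (simp add: S_def sum_nonneg log_plus_nonneg)
  have "x j \<le> exp S" if j: "j \<in> J" for j
  proof (cases "x j = 0")
    case False
    then have "x j = exp (ln (x j))" using x[OF j] by simp
    also have "ln (x j) \<le> log_plus (x j)" by (simp add: log_plus_def)
    also have "log_plus (x j) \<le> S"
      unfolding S_def using j \<open>finite J\<close> by (intro member_le_sum log_plus_nonneg) auto
    finally show ?thesis by simp
  qed simp
  then have "(\<Sum>j\<in>J. x j) \<le> real (card J) * exp S"
    using sum_bounded_above[of J x "exp S"] by simp
  then have "c * (\<Sum>j\<in>J. x j) \<le> c * (real (card J) * exp S)" using \<open>c \<ge> 1\<close> by (intro mult_left_mono) auto
  also have "\<dots> \<le> c * (real (card J) + 1) * exp S"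
    using \<open>c \<ge> 1\<close> by (simp add: algebra_simps)
  finally have "c * (\<Sum>j\<in>J. x j) \<le> c * (real (card J) + 1) * exp S" .
  moreover have "1 * 1 * 1 \<le> c * (real (card J) + 1) * exp S"
    using \<open>c \<ge> 1\<close> \<open>S \<ge> 0\<close> by (intro mult_mono) auto
  ultimately have "ln (max 1 (c * (\<Sum>j\<in>J. x j))) \<le> ln (c * (real (card J) + 1) * exp S)"
    by (intro ln_mono) auto
  also have "\<dots> = ln (c * (real (card J) + 1)) + S" using \<open>c \<ge> 1\<close> by (simp add: ln_mult)
  finally show ?thesis using x \<open>c \<ge> 1\<close> by (simp add: log_plus_eq sum_nonneg S_def)
qed

text \<open>The radius \<open>r\<close> depends on the solutions and on \<open>R\<close>, but not on
  \<open>v\<close>. The two hypotheses on \<open>v\<close> differ by an exponential: the solutions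
  enter the conclusion only through the logarithm of their characteristic.\<close>

lemma coefficient_proximity_bound:
  fixes f A :: "nat \<Rightarrow> complex \<Rightarrow> complex"
  assumes f: "\<And>i. i \<le> n \<Longrightarrow> f i holomorphic_on UNIV"
    and indep: "\<And>c. (\<And>z. (\<Sum>i\<le>n. c i * f i z) = 0) \<Longrightarrow> \<forall>i\<le>n. c i = 0"
    and A: "\<And>j. j \<le> K \<Longrightarrow> A j holomorphic_on UNIV" and "n \<le> K"
    and eq: "\<And>i z. i \<le> n \<Longrightarrow> (\<Sum>j\<le>K. A j z * (deriv ^^ j) (f i) z) = 0"
  shows "\<exists>C\<ge>1. \<exists>d\<ge>4. \<forall>R\<ge>2. \<exists>r. R \<le> r \<and> r \<le> d * R \<and> (\<forall>v\<ge>1.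
    (\<forall>i\<le>n. proximity (d * R) (f i) \<le> exp v) \<longrightarrow> (\<forall>j\<in>{n<..K}. proximity r (A j) \<le> v) \<longrightarrow>
    proximity R (A n) \<le> C * v)"
proof -
  define L where "L i r = (SUP z\<in>cball 0 r. log_plus (norm (f i z)))" for i r
  define \<Phi> where "\<Phi> r = 1 + (\<Sum>i\<le>n. L i r)" for r
  have bdd: "bdd_above ((\<lambda>z. log_plus (norm (f i z))) ` cball 0 r)" if "i \<le> n" for i r
    by (intro bounded_imp_bdd_above compact_imp_bounded compact_continuous_image
        continuous_on_log_plus_norm continuous_on_subset[OF holomorphic_on_imp_continuous_on[OF f[OF that]]]) auto
  have L_ge: "log_plus (norm (f i z)) \<le> L i r" if "i \<le> n" "norm z \<le> r" for i r z
    unfolding L_def using that by (intro cSUP_upper bdd) auto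
  have L_nonneg: "0 \<le> L i r" if "i \<le> n" "r \<ge> 1" for i r
    using order_trans[OF log_plus_nonneg L_ge[OF that(1), of 0 r]] that by simp
  have L_mono: "L i x \<le> L i y" if "i \<le> n" "1 \<le> x" "x \<le> y" for i x y
    unfolding L_def using that by (intro cSUP_subset_mono bdd) auto
  have \<Phi>: "\<And>x. 1 \<le> x \<Longrightarrow> 1 \<le> \<Phi> x" "\<And>x y. 1 \<le> x \<Longrightarrow> x \<le> y \<Longrightarrow> \<Phi> x \<le> \<Phi> y"
    unfolding \<Phi>_def using L_nonneg L_mono by (auto intro!: sum_nonneg sum_mono)
  have f_class: "f i \<in> growth_class \<Phi>" if i: "i \<le> n" for i
  proof -
    have "norm (f i z) \<le> exp (1 * \<Phi> (1 * r))" if "r \<ge> 1" "norm z \<le> r" for r z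
    proof (cases "f i z = 0")
      case False
      have "ln (norm (f i z)) \<le> log_plus (norm (f i z))" by (simp add: log_plus_def)
      also have "\<dots> \<le> L i r" using i that by (intro L_ge)
      also have "\<dots> \<le> (\<Sum>i\<le>n. L i r)" using i L_nonneg \<open>r \<ge> 1\<close> by (intro member_le_sum) auto
      finally have "ln (norm (f i z)) \<le> \<Phi> r" by (simp add: \<Phi>_def)
      with False show ?thesis by (metis exp_le_cancel_iff exp_ln mult_1 zero_less_norm_iff)
    qed simp
    then show ?thesis unfolding growth_class_def using f[OF i] by blast
  qed
  obtain Ws where Ws: "finite Ws" "Ws \<subseteq> growth_class \<Phi>" "\<forall>W\<in>Ws. \<exists>z. W z \<noteq> 0"
    and jet: "jet_bound Ws f n K"
  proof -
    have "\<exists>Ws. finite Ws \<and> Ws \<subseteq> growth_class \<Phi> \<and> (\<forall>W\<in>Ws. \<exists>z. W z \<noteq> 0) \<and> (\<forall>K\<ge>n. jet_bound Ws f n K)"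
    proof (rule reduction_of_order)
      show "g holomorphic_on UNIV" if "g \<in> growth_class \<Phi>" for g using that by (simp add: growth_class_def)
      show "(\<lambda>z. g z * deriv h z - h z * deriv g z) \<in> growth_class \<Phi>"
        if "g \<in> growth_class \<Phi>" "h \<in> growth_class \<Phi>" for g h
        by (rule growth_class_closed[OF \<Phi> that])
      show "f i \<in> growth_class \<Phi>" if "i \<le> n" for i using that by (rule f_class)
      show "\<forall>i\<le>n. c i = 0" if "\<And>z. (\<Sum>i\<le>n. c i * f i z) = 0" for c using that by (rule indep)
    qed
    then show thesis using \<open>n \<le> K\<close> that by blast
  qed
  obtain C1 N where "C1 \<ge> 1" and C1: "\<forall>\<rho> z a. 0 < \<rho> \<longrightarrow> \<rho> \<le> 1 \<longrightarrow>
      (\<forall>W\<in>Ws. steady \<rho> z W) \<longrightarrow> (\<forall>i\<le>n. (\<Sum>j\<le>K. a j * (deriv ^^ j) (f i) z) = 0) \<longrightarrow>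
      norm (a n) \<le> C1 * (1 / \<rho>) ^ N * (\<Sum>j\<in>{n<..K}. norm (a j))"
    using jet unfolding jet_bound_def by (elim exE conjE) (rule that)
  have W_holo: "W holomorphic_on UNIV" if "W \<in> Ws" for W using that Ws(2) by (auto simp: growth_class_def)
  obtain C2 where "C2 \<ge> 1" and C2: "\<forall>R\<ge>2. \<forall>B\<ge>0. (\<forall>W\<in>Ws. \<forall>z. norm z \<le> 65 * R \<longrightarrow> norm (W z) \<le> exp B) \<longrightarrow>
     (\<exists>r. R \<le> r \<and> r \<le> 2 * R \<and>
       (\<forall>z. norm z = r \<longrightarrow> (\<forall>W\<in>Ws. steady (1 / (9 * (C2 * (B + 1))\<^sup>2)) z W)))"
  proof (rule exE[OF steady_on_circle[OF Ws(1)]])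
    show "W holomorphic_on UNIV" if "W \<in> Ws" for W using that by (rule W_holo)
    show "\<exists>z. W z \<noteq> 0" if "W \<in> Ws" for W using that Ws(3) by blast
  qed (elim conjE, rule that)
  have "\<forall>W\<in>Ws. \<exists>C\<ge>1. \<forall>r\<ge>1. \<forall>z. norm z \<le> r \<longrightarrow> norm (W z) \<le> exp (C * \<Phi> (C * r))"
    using Ws(2) unfolding growth_class_def by blast
  then obtain CW where CW: "\<And>W. W \<in> Ws \<Longrightarrow> CW W \<ge> 1"
    "\<And>W r z. W \<in> Ws \<Longrightarrow> r \<ge> 1 \<Longrightarrow> norm z \<le> r \<Longrightarrow> norm (W z) \<le> exp (CW W * \<Phi> (CW W * r))"
    by metis
  define C3 where "C3 = 1 + (\<Sum>W\<in>Ws. CW W)"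
  have "C3 \<ge> 1" unfolding C3_def using CW(1) by (smt (verit) sum_nonneg)
  have C3: "norm (W z) \<le> exp (C3 * \<Phi> (C3 * r))" if "W \<in> Ws" "r \<ge> 1" "norm z \<le> r" for W r z
  proof -
    have "CW W \<le> (\<Sum>W\<in>Ws. CW W)"
      using that Ws(1) CW(1) by (intro member_le_sum) (auto intro: order_trans[of 0 1])
    then have "CW W \<le> C3" by (simp add: C3_def)
    have "norm (W z) \<le> exp (CW W * \<Phi> (CW W * r))" using that by (intro CW(2))
    also have "\<dots> \<le> exp (C3 * \<Phi> (C3 * r))"
      by (rule growth_bound_mono[OF \<Phi> CW(1)[OF that(1)] \<open>CW W \<le> C3\<close> that(2)]) auto
    finally show ?thesis .
  qed
  \<comment> \<open>This is the constant in \<open>ln Y \<le> \<Lambda> + v\<close>: there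
    \<open>3 * n + 4 = 1 + 3 * (n + 1)\<close> comes from \<open>\<Phi>\<close>, and the factor 2
    from \<open>B + 1 \<le> 2 * B\<close>.\<close>
  define \<Lambda> where "\<Lambda> = ln (2 * C2 * C3 * (3 * real n + 4))"
  \<comment> \<open>The pivots are bounded on radius \<open>65 * (2 * R) = 130 * R\<close>, the
    growth class dilates it by \<open>C3\<close>, and passing from maximum modulus to proximity
    doubles it again.\<close>
  define d where "d = 260 * C3"
  \<comment> \<open>The factor 3 is that of \<open>proximity_le_proximity_double\<close>, the
    bracket bounds \<open>ln (c * (K + 1))\<close> plus at most \<open>K\<close> proximity terms in
    units of \<open>v\<close>.\<close>
  define C where "C = 1 + 3 * (ln (C1 * (real K + 1)) + real N * (ln 9 + 2 * \<Lambda> + 2) + real K)"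
  have "1 * 1 * 1 \<le> (2 * C2) * C3 * (3 * real n + 4)"
    using \<open>C2 \<ge> 1\<close> \<open>C3 \<ge> 1\<close> by (intro mult_mono) auto
  then have "\<Lambda> \<ge> 0" by (simp add: \<Lambda>_def)
  have "1 * 1 \<le> C1 * (real K + 1)" using \<open>C1 \<ge> 1\<close> by (intro mult_mono) auto
  then have lnC1: "0 \<le> ln (C1 * (real K + 1))" by simp
  have "d \<ge> 4" using \<open>C3 \<ge> 1\<close> by (simp add: d_def)
  have C_nonneg: "0 \<le> ln (C1 * (real K + 1)) + real N * (ln 9 + 2 * \<Lambda> + 2) + real K"
    using lnC1 \<open>\<Lambda> \<ge> 0\<close> by (intro add_nonneg_nonneg mult_nonneg_nonneg) auto
  then have "C \<ge> 1" by (simp add: C_def)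
  show ?thesis
  proof (rule exI[of _ C], rule conjI[OF \<open>C \<ge> 1\<close>], rule exI[of _ d], rule conjI[OF \<open>d \<ge> 4\<close>],
      intro allI impI)
    fix R :: real assume "R \<ge> 2"
    define s where "s = C3 * (130 * R)"
    have "1 * 1 \<le> s" unfolding s_def using \<open>C3 \<ge> 1\<close> \<open>R \<ge> 2\<close> by (intro mult_mono) auto
    then have "s \<ge> 1" by simp
    define B where "B = C3 * \<Phi> s"
    define Y where "Y = C2 * (B + 1)"
    have \<Phi>s: "\<Phi> s \<ge> 1" using \<Phi>(1)[OF \<open>s \<ge> 1\<close>] .
    then have "B \<ge> 0" using \<open>C3 \<ge> 1\<close> by (simp add: B_def)
    have "1 * 1 \<le> Y" unfolding Y_def using \<open>C2 \<ge> 1\<close> \<open>B \<ge> 0\<close> by (intro mult_mono) auto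
    then have "Y \<ge> 1" by simp
    \<comment> \<open>The circle is sought from \<open>2 * R\<close> onwards, so that proximity at
      \<open>R\<close> is controlled by proximity at \<open>r\<close>.\<close>
    have "\<forall>W\<in>Ws. \<forall>z. norm z \<le> 65 * (2 * R) \<longrightarrow> norm (W z) \<le> exp B"
      using C3[of _ "130 * R"] \<open>R \<ge> 2\<close> by (simp add: B_def s_def)
    moreover have "2 \<le> 2 * R" using \<open>R \<ge> 2\<close> by simp
    ultimately obtain r where r: "2 * R \<le> r" "r \<le> 2 * (2 * R)"
      and st: "\<And>z W. norm z = r \<Longrightarrow> W \<in> Ws \<Longrightarrow> steady (1 / (9 * Y\<^sup>2)) z W"
      using C2[rule_format, of "2 * R" B] \<open>B \<ge> 0\<close> unfolding Y_def by auto
    define c where "c = C1 * (9 * Y\<^sup>2) ^ N"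
    have Y2: "1 \<le> 9 * Y\<^sup>2" using one_le_power[OF \<open>Y \<ge> 1\<close>, of 2] by simp
    have "1 * 1 \<le> c" unfolding c_def using \<open>C1 \<ge> 1\<close> Y2 by (intro mult_mono one_le_power) auto
    then have "c \<ge> 1" by simp
    have pw: "log_plus (norm (A n z)) \<le>
        ln (c * (real K + 1)) + (\<Sum>j\<in>{n<..K}. log_plus (norm (A j z)))" if z: "norm z = r" for z
    proof -
      have "norm (A n z) \<le> C1 * (1 / (1 / (9 * Y\<^sup>2))) ^ N * (\<Sum>j\<in>{n<..K}. norm (A j z))"
        by (rule C1[rule_format, of "1 / (9 * Y\<^sup>2)" z "\<lambda>j. A j z"])
           (use Y2 \<open>Y \<ge> 1\<close> st[OF z] eq in \<open>auto simp: divide_le_eq\<close>)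
      then have "log_plus (norm (A n z)) \<le> log_plus (c * (\<Sum>j\<in>{n<..K}. norm (A j z)))"
        by (intro log_plus_mono) (auto simp: c_def)
      also have "\<dots> \<le> ln (c * (real (card {n<..K}) + 1)) + (\<Sum>j\<in>{n<..K}. log_plus (norm (A j z)))"
        using \<open>c \<ge> 1\<close> by (intro log_plus_sum_le) auto
      also have "ln (c * (real (card {n<..K}) + 1)) \<le> ln (c * (real K + 1))"
        using \<open>c \<ge> 1\<close> by (intro ln_mono mult_left_mono) auto
      finally show ?thesis by simp
    qed
    have "proximity R (A n) \<le> 3 * proximity r (A n)"
      using r \<open>R \<ge> 2\<close> A \<open>n \<le> K\<close> by (intro proximity_le_proximity_double) auto
    also have "proximity r (A n) \<le> ln (c * (real K + 1)) + (\<Sum>j\<in>{n<..K}. proximity r (A j))"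
      using A \<open>n \<le> K\<close> r \<open>R \<ge> 2\<close> by (intro proximity_le pw) auto
    finally have prox: "proximity R (A n) \<le> 3 * (ln (c * (real K + 1)) + (\<Sum>j\<in>{n<..K}. proximity r (A j)))"
      by simp
    have "proximity R (A n) \<le> C * v"
      if "v \<ge> 1" and vf: "\<forall>i\<le>n. proximity (d * R) (f i) \<le> exp v"
        and vA: "\<forall>j\<in>{n<..K}. proximity r (A j) \<le> v" for v
    proof -
      have "L i s \<le> 3 * exp v" if i: "i \<le> n" for i
        unfolding L_def
      proof (rule cSUP_least)
        show "cball (0::complex) s \<noteq> {}" using \<open>s \<ge> 1\<close> by simp
        fix z :: complex assume "z \<in> cball 0 s"
        then have "log_plus (norm (f i z)) \<le> 3 * proximity (d * R) (f i)"
          using \<open>s \<ge> 1\<close> by (intro log_plus_le_proximity f i) (auto simp: d_def s_def)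
        also have "\<dots> \<le> 3 * exp v" using vf i by simp
        finally show "log_plus (norm (f i z)) \<le> 3 * exp v" .
      qed
      then have "(\<Sum>i\<le>n. L i s) \<le> (\<Sum>i\<le>n. 3 * exp v)" by (intro sum_mono) auto
      moreover have "1 \<le> exp v" using \<open>v \<ge> 1\<close> by simp
      ultimately have "\<Phi> s \<le> exp v + real (Suc n) * (3 * exp v)" 
        unfolding \<Phi>_def by (simp only: sum_constant card_atMost)
      then have \<Phi>_le: "\<Phi> s \<le> (3 * real n + 4) * exp v" by (simp add: algebra_simps)
      have "1 * 1 \<le> C3 * \<Phi> s" using \<open>C3 \<ge> 1\<close> \<Phi>s by (intro mult_mono) auto
      then have "B + 1 \<le> 2 * (C3 * \<Phi> s)" by (simp add: B_def)
      then have "Y \<le> C2 * (2 * (C3 * \<Phi> s))" unfolding Y_def using \<open>C2 \<ge> 1\<close> by (intro mult_left_mono) auto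
      also have "\<dots> \<le> C2 * (2 * (C3 * ((3 * real n + 4) * exp v)))"
        using \<open>C2 \<ge> 1\<close> \<open>C3 \<ge> 1\<close> \<Phi>_le by (intro mult_left_mono) auto
      also have "\<dots> = 2 * C2 * C3 * (3 * real n + 4) * exp v" by (simp add: mult_ac)
      finally have "ln Y \<le> ln (2 * C2 * C3 * (3 * real n + 4) * exp v)"
        using \<open>Y \<ge> 1\<close> by (intro ln_mono) auto
      also have "\<dots> = \<Lambda> + v"
        using \<open>C2 \<ge> 1\<close> \<open>C3 \<ge> 1\<close> by (subst ln_mult) (auto simp: \<Lambda>_def)
      finally have lnY: "ln Y \<le> \<Lambda> + v" .
      have "c * (real K + 1) = (C1 * (real K + 1)) * (9 * Y\<^sup>2) ^ N" by (simp add: c_def)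
      also have "ln \<dots> = ln (C1 * (real K + 1)) + ln ((9 * Y\<^sup>2) ^ N)"
        using \<open>C1 \<ge> 1\<close> \<open>Y \<ge> 1\<close> by (intro ln_mult_pos) auto
      also have "ln ((9 * Y\<^sup>2) ^ N) = real N * (ln 9 + 2 * ln Y)"
        using \<open>Y \<ge> 1\<close> by (simp add: ln_realpow ln_mult_pos distrib_left)
      finally have ln_c: "ln (c * (real K + 1)) = ln (C1 * (real K + 1)) + real N * (ln 9 + 2 * ln Y)" .
      have "(\<Sum>j\<in>{n<..K}. proximity r (A j)) \<le> real (card {n<..K}) * v"
        using vA by (intro sum_bounded_above) auto
      also have "\<dots> \<le> real K * v" using \<open>v \<ge> 1\<close> by (intro mult_right_mono) auto
      finally have sum_le: "(\<Sum>j\<in>{n<..K}. proximity r (A j)) \<le> real K * v" .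
      have "ln 9 + 2 * ln Y \<le> (ln 9 + 2 * \<Lambda>) * 1 + 2 * v" using lnY by simp
      also have "\<dots> \<le> (ln 9 + 2 * \<Lambda>) * v + 2 * v"
        using \<open>\<Lambda> \<ge> 0\<close> \<open>v \<ge> 1\<close> by (intro add_right_mono mult_left_mono) auto
      finally have "real N * (ln 9 + 2 * ln Y) \<le> real N * ((ln 9 + 2 * \<Lambda> + 2) * v)"
        by (intro mult_left_mono) (auto simp: algebra_simps)
      moreover have "ln (C1 * (real K + 1)) * 1 \<le> ln (C1 * (real K + 1)) * v"
        using lnC1 \<open>v \<ge> 1\<close> by (intro mult_left_mono) auto
      ultimately have "ln (c * (real K + 1)) + (\<Sum>j\<in>{n<..K}. proximity r (A j)) \<le>
          (ln (C1 * (real K + 1)) + real N * (ln 9 + 2 * \<Lambda> + 2) + real K) * v"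
        using ln_c sum_le by (simp add: algebra_simps)
      then have "proximity R (A n) \<le>
          3 * ((ln (C1 * (real K + 1)) + real N * (ln 9 + 2 * \<Lambda> + 2) + real K) * v)"
        by (intro order_trans[OF prox] mult_left_mono) auto
      also have "\<dots> = (C - 1) * v" by (simp add: C_def)
      also have "\<dots> \<le> C * v" using \<open>v \<ge> 1\<close> by (intro mult_right_mono) auto
      finally show ?thesis .
    qed
    moreover have "R \<le> r" "r \<le> d * R"
    proof -
      show "R \<le> r" using r \<open>R \<ge> 2\<close> by simp
      have "4 * R \<le> d * R" using \<open>d \<ge> 4\<close> \<open>R \<ge> 2\<close> by (intro mult_right_mono) auto
      then show "r \<le> d * R" using r by simp
    qed
    ultimately show "\<exists>r. R \<le> r \<and> r \<le> d * R \<and> (\<forall>v\<ge>1.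
      (\<forall>i\<le>n. proximity (d * R) (f i) \<le> exp v) \<longrightarrow> (\<forall>j\<in>{n<..K}. proximity r (A j) \<le> v) \<longrightarrow>
      proximity R (A n) \<le> C * v)" by blast
  qed
qed


section \<open>Growth scales\<close>

lemma class_L_mono:
  assumes "\<alpha> \<in> class_L" and "x \<le> y"
  shows "\<alpha> x \<le> \<alpha> y"
proof -
  obtain x0 where left: "\<forall>x\<le>x0. \<alpha> x = \<alpha> x0" and mono: "strict_mono_on {x0..} \<alpha>"
    using assms(1) unfolding class_L_def mem_Collect_eq by (elim conjE exE) (rule that)
  have eq: "\<alpha> u = \<alpha> (max u x0)" for u
    using spec[OF left, of u] by (cases "u \<le> x0") (simp_all add: max_def)
  have "\<alpha> (max x x0) \<le> \<alpha> (max y x0)"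
    using assms(2) by (intro strict_mono_on_leD[OF mono]) auto
  then show ?thesis by (simp only: eq[symmetric])
qed

lemma class_L_nonneg: "\<alpha> \<in> class_L \<Longrightarrow> 0 \<le> \<alpha> x"
  by (simp add: class_L_def)

lemma class_L_at_top: "\<alpha> \<in> class_L \<Longrightarrow> filterlim \<alpha> at_top at_top"
  by (simp add: class_L_def)

text \<open>A generalized inverse of \<open>\<alpha>\<close>: the chosen \<open>y\<close> dominates
  the whole sublevel set, including the part where \<open>\<alpha>\<close> is constant, so bounds on
  \<open>\<alpha> x\<close> become bounds on \<open>x\<close>. Raising the level makes
  \<open>y\<close> as large as desired.\<close>

lemma class_L_attains:
  assumes \<alpha>: "\<alpha> \<in> class_L"
  shows "\<exists>t. \<forall>u\<ge>t. \<exists>y\<ge>X. \<alpha> y = u \<and> (\<forall>x. \<alpha> x \<le> u \<longrightarrow> x \<le> y)"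
proof -
  obtain x0 where mono: "strict_mono_on {x0..} \<alpha>"
    using \<alpha> unfolding class_L_def mem_Collect_eq by (elim conjE exE) (rule that)
  define X' where "X' = max X x0"
  have "\<exists>y\<ge>X. \<alpha> y = u \<and> (\<forall>x. \<alpha> x \<le> u \<longrightarrow> x \<le> y)" if u: "u \<ge> \<alpha> X'" for u
  proof -
    have "eventually (\<lambda>b. u \<le> \<alpha> b \<and> X' \<le> b) at_top"
      using class_L_at_top[OF \<alpha>] eventually_ge_at_top by (intro eventually_conj) (auto simp: filterlim_at_top)
    then obtain b where b: "u \<le> \<alpha> b" "X' \<le> b" using eventually_happens[of _ "at_top :: real filter"] by auto
    have "continuous_on {X'..b} \<alpha>" using \<alpha> continuous_on_subset by (auto simp: class_L_def)
    then obtain y where y: "X' \<le> y" "\<alpha> y = u" using IVT'[of \<alpha> X' u b] u b by auto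
    have "x \<le> y" if "\<alpha> x \<le> u" for x
    proof (rule ccontr)
      assume "\<not> x \<le> y"
      then have "\<alpha> y < \<alpha> x" using y(1) by (intro strict_mono_onD[OF mono]) (auto simp: X'_def)
      with that y(2) show False by simp
    qed
    then show ?thesis using y by (auto simp: X'_def)
  qed
  then show ?thesis by blast
qed

text \<open>Subadditivity at equal arguments, iterated, gives
  \<open>\<gamma> (2 ^ p * x) \<le> 2 ^ p * \<gamma> x\<close>; the logarithm turns the factor into
  a summand.\<close>

lemma class_L3_scaling:
  assumes \<gamma>: "\<gamma> \<in> class_L3"
  shows "\<exists>c. eventually (\<lambda>R. 0 < \<gamma> R \<and> ln (\<gamma> (d * R)) \<le> ln (\<gamma> R) + c) at_top"
proof -
  have L: "\<gamma> \<in> class_L" using \<gamma> by (simp add: class_L3_def)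
  obtain R0 where sub: "\<And>a b. a \<ge> R0 \<Longrightarrow> b \<ge> R0 \<Longrightarrow> \<gamma> (a + b) \<le> \<gamma> a + \<gamma> b"
    using \<gamma> unfolding class_L3_def by blast
  have pow: "\<gamma> (2 ^ p * x) \<le> 2 ^ p * \<gamma> x" if "x \<ge> R0" "x \<ge> 0" for p x
  proof (induction p)
    case (Suc p)
    have "1 * x \<le> 2 ^ p * x" using that by (intro mult_right_mono) auto
    then have "\<gamma> (2 ^ p * x + 2 ^ p * x) \<le> \<gamma> (2 ^ p * x) + \<gamma> (2 ^ p * x)"
      using that by (intro sub) auto
    moreover have "\<gamma> (2 ^ Suc p * x) = \<gamma> (2 ^ p * x + 2 ^ p * x)" by (rule arg_cong) simp
    moreover have "2 ^ Suc p * \<gamma> x = 2 * (2 ^ p * \<gamma> x)" by simp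
    ultimately show ?case using Suc by linarith
  qed simp
  obtain p where p: "d < 2 ^ p" using real_arch_pow[of 2 d] by auto
  have "eventually (\<lambda>R. 1 \<le> \<gamma> R \<and> R0 \<le> R \<and> 0 \<le> R) at_top"
    using class_L_at_top[OF L] eventually_ge_at_top
    by (intro eventually_conj) (auto simp: filterlim_at_top)
  then have "eventually (\<lambda>R. 0 < \<gamma> R \<and> ln (\<gamma> (d * R)) \<le> ln (\<gamma> R) + real p * ln 2) at_top"
  proof eventually_elim
    case (elim R)
    have "\<gamma> (d * R) \<le> \<gamma> (2 ^ p * R)"
      using p elim by (intro class_L_mono[OF L] mult_right_mono) auto
    also have "\<dots> \<le> 2 ^ p * \<gamma> R" using elim by (intro pow) auto
    finally have le: "\<gamma> (d * R) \<le> 2 ^ p * \<gamma> R" .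
    show ?case
    proof (cases "\<gamma> (d * R) = 0")
      \<comment> \<open>Here \<open>ln 0 = 0\<close> is the value on the left, and
        \<open>\<gamma> R \<ge> 1\<close> makes the right side nonnegative.\<close>
      case True
      then show ?thesis using elim by simp
    next
      case False
      then have "0 < \<gamma> (d * R)" using class_L_nonneg[OF L, of "d * R"] by linarith
      then have "ln (\<gamma> (d * R)) \<le> ln (2 ^ p * \<gamma> R)" using le by (intro ln_mono) auto
      also have "\<dots> = ln (\<gamma> R) + real p * ln 2" using elim by (simp add: ln_mult_pos ln_realpow)
      finally show ?thesis using elim by simp
    qed
  qed
  then show ?thesis by blast
qed

lemma class_L2_shift:
  assumes \<beta>: "\<beta> \<in> class_L2" and "q > 1"
  shows "eventually (\<lambda>y. \<beta> (y + c) \<le> q * \<beta> y) at_top"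
proof -
  have L: "\<beta> \<in> class_L" using \<beta> by (simp add: class_L2_def)
  have "(\<lambda>_::real. c) \<in> O[at_top](\<lambda>_. 1 :: real)" by simp
  then have "(\<lambda>y. \<beta> (y + c)) \<sim>[at_top] \<beta>" using \<beta> unfolding class_L2_def by auto
  moreover have pos: "eventually (\<lambda>y. 0 < \<beta> y) at_top"
    using class_L_at_top[OF L] by (auto simp: filterlim_at_top_dense)
  ultimately have "((\<lambda>y. \<beta> (y + c) / \<beta> y) \<longlongrightarrow> 1) at_top"
    by (intro asymp_equivD_strong) (auto elim: eventually_mono)
  then have "eventually (\<lambda>y. \<beta> (y + c) / \<beta> y < q) at_top"
    using \<open>q > 1\<close> by (rule order_tendstoD(2))
  with pos show ?thesis by eventually_elim (simp add: field_simps)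
qed

lemma scale_at_top:
  assumes "\<beta> \<in> class_L" and "\<gamma> \<in> class_L"
  shows "filterlim (\<lambda>r. \<beta> (ln (\<gamma> r))) at_top at_top"
  by (intro filterlim_compose[OF class_L_at_top[OF assms(1)]]
      filterlim_compose[OF ln_at_top] class_L_at_top[OF assms(2)])

text \<open>A dilation by \<open>d\<close> shifts \<open>ln (\<gamma> R)\<close> by a bounded
  amount, and the \<open>class_L2\<close> property reduces this shift to a factor arbitrarily close
  to 1. Monotonicity gives all intermediate \<open>x\<close> at once.\<close>

lemma scale_slowly_varying:
  assumes \<beta>: "\<beta> \<in> class_L2" and \<gamma>: "\<gamma> \<in> class_L3" and "q > 1" and "d \<ge> 1"
  shows "eventually (\<lambda>R. \<forall>x. R \<le> x \<and> x \<le> d * R \<longrightarrow> \<beta> (ln (\<gamma> x)) \<le> q * \<beta> (ln (\<gamma> R))) at_top"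
proof -
  have L: "\<beta> \<in> class_L" "\<gamma> \<in> class_L" using \<beta> \<gamma> by (simp_all add: class_L2_def class_L3_def)
  obtain c where c: "eventually (\<lambda>R. 0 < \<gamma> R \<and> ln (\<gamma> (d * R)) \<le> ln (\<gamma> R) + c) at_top"
    using class_L3_scaling[OF \<gamma>] by blast
  have "filterlim (\<lambda>R. ln (\<gamma> R)) at_top at_top"
    by (intro filterlim_compose[OF ln_at_top] class_L_at_top L)
  from eventually_compose_filterlim[OF class_L2_shift[OF \<beta> \<open>q > 1\<close>] this]
  have "eventually (\<lambda>R. \<beta> (ln (\<gamma> R) + c) \<le> q * \<beta> (ln (\<gamma> R))) at_top" .
  with c show ?thesis
  proof eventually_elim
    case (elim R)
    have "\<beta> (ln (\<gamma> x)) \<le> q * \<beta> (ln (\<gamma> R))" if x: "R \<le> x" "x \<le> d * R" for x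
    proof -
      have "0 < \<gamma> x" using class_L_mono[OF L(2) x(1)] elim by simp
      then have "ln (\<gamma> x) \<le> ln (\<gamma> (d * R))"
        using class_L_mono[OF L(2) x(2)] by (intro ln_mono) auto
      also have "\<dots> \<le> ln (\<gamma> R) + c" using elim by simp
      finally have "\<beta> (ln (\<gamma> x)) \<le> \<beta> (ln (\<gamma> R) + c)" by (rule class_L_mono[OF L(1)])
      with elim show ?thesis by simp
    qed
    then show ?case by blast
  qed
qed

text \<open>Nonnegative numerators force \<open>\<mu> > 0\<close>, which later permits
  \<open>\<nu> / \<mu>\<close> as the factor of slow variation.\<close>

lemma Limsup_ratio_less:
  fixes N w :: "real \<Rightarrow> real"
  assumes "Limsup at_top (\<lambda>r. ereal (N r / w r)) < ereal l"
    and w: "eventually (\<lambda>r. 0 < w r) at_top" and N: "\<And>r. 0 \<le> N r"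
  obtains \<mu> where "0 < \<mu>" "\<mu> < l" "eventually (\<lambda>r. N r \<le> \<mu> * w r) at_top"
proof -
  obtain \<mu> where \<mu>: "Limsup at_top (\<lambda>r. ereal (N r / w r)) < ereal \<mu>" "\<mu> < l"
    using ereal_dense2[OF assms(1)] by auto
  have ev: "eventually (\<lambda>r. N r / w r < \<mu>) at_top"
    using Limsup_lessD[OF \<mu>(1)] by simp
  then have "eventually (\<lambda>r. N r / w r < \<mu> \<and> 0 < w r) at_top" using w by (rule eventually_conj)
  then obtain r where "N r / w r < \<mu>" "0 < w r"
    using eventually_happens[of _ "at_top :: real filter"] by auto
  then have "0 < \<mu>" using N[of r] by (meson divide_nonneg_pos le_less_trans)
  moreover have "eventually (\<lambda>r. N r \<le> \<mu> * w r) at_top"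
    using ev w by eventually_elim (simp add: field_simps)
  ultimately show thesis using that \<mu>(2) by blast
qed

lemma Limsup_ratio_less_uniform:
  fixes w :: "real \<Rightarrow> real" and I :: "(real \<Rightarrow> real) set"
  assumes "finite I" "I \<noteq> {}"
    and less: "\<And>N. N \<in> I \<Longrightarrow> Limsup at_top (\<lambda>r. ereal (N r / w r)) < ereal l"
    and w: "eventually (\<lambda>r. 0 < w r) at_top" and nonneg: "\<And>N r. N \<in> I \<Longrightarrow> 0 \<le> N r"
  obtains \<mu> where "0 < \<mu>" "\<mu> < l" "eventually (\<lambda>r. \<forall>N\<in>I. N r \<le> \<mu> * w r) at_top"
proof -
  have "\<exists>\<mu>. 0 < \<mu> \<and> \<mu> < l \<and> eventually (\<lambda>r. N r \<le> \<mu> * w r) at_top" if "N \<in> I" for N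
    using Limsup_ratio_less[OF less[OF that] w nonneg[OF that]] by blast
  then obtain \<mu> where \<mu>: "\<And>N. N \<in> I \<Longrightarrow> 0 < \<mu> N \<and> \<mu> N < l \<and> eventually (\<lambda>r. N r \<le> \<mu> N * w r) at_top"
    by metis
  define \<nu> where "\<nu> = Max (\<mu> ` I)"
  have \<nu>: "\<nu> \<in> \<mu> ` I" unfolding \<nu>_def using assms(1,2) by (intro Max_in) auto
  have le: "\<mu> N \<le> \<nu>" if "N \<in> I" for N unfolding \<nu>_def using that assms(1) by (intro Max_ge) auto
  have "eventually (\<lambda>r. \<forall>N\<in>I. N r \<le> \<mu> N * w r) at_top"
    using \<mu> assms(1) by (intro eventually_ball_finite) auto
  with w have "eventually (\<lambda>r. \<forall>N\<in>I. N r \<le> \<nu> * w r) at_top"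
    by eventually_elim (use le in \<open>force intro: order_trans mult_right_mono\<close>)
  moreover have "0 < \<nu>" "\<nu> < l" using \<nu> \<mu> by auto
  ultimately show thesis using that by blast
qed

text \<open>The negated conclusion also covers an infinite \<open>S\<close>; in either case some
  \<open>m + 1\<close> members exist, and indexing them gives the coefficient form of independence
  on which the reduction operates.\<close>

lemma independent_family:
  fixes S :: "(complex \<Rightarrow> complex) set"
  assumes "cfun.independent S" and "\<not> (finite S \<and> card S \<le> m)"
  obtains f where "\<forall>i\<le>m. f i \<in> S" "\<forall>c. (\<forall>z. (\<Sum>i\<le>m. c i * f i z) = 0) \<longrightarrow> (\<forall>i\<le>m. c i = 0)"
proof -
  have "\<exists>T. T \<subseteq> S \<and> finite T \<and> card T = Suc m"
  proof (cases "finite S")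
    case True
    then have "Suc m \<le> card S" using assms(2) by simp
    then show ?thesis using obtain_subset_with_card_n[of "Suc m" S] by metis
  next
    case False
    then show ?thesis using infinite_arbitrarily_large by blast
  qed
  then obtain T where T: "T \<subseteq> S" "finite T" "card T = Suc m" by blast
  obtain f where "bij_betw f {0..<card T} T" using ex_bij_betw_nat_finite[OF T(2)] by blast
  then have f: "bij_betw f {..m} T" by (simp add: T(3) atLeast0LessThan lessThan_Suc_atMost)
  have "\<forall>i\<le>m. c i = 0" if c: "\<And>z. (\<Sum>i\<le>m. c i * f i z) = 0" for c
  proof -
    define u where "u v = c (inv_into {..m} f v)" for v
    have u: "u (f i) = c i" if "i \<le> m" for i
      using f that by (simp add: u_def bij_betw_inv_into_left)
    have "(\<Sum>v\<in>T. (\<lambda>z. u v * v z)) z = 0" for z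
    proof -
      have "(\<Sum>v\<in>T. (\<lambda>z. u v * v z)) z = (\<Sum>v\<in>T. u v * v z)"
        using T(2) by (induction T rule: finite_induct) (auto simp: plus_fun_def zero_fun_def)
      also have "\<dots> = (\<Sum>i\<le>m. u (f i) * f i z)" by (rule sum.reindex_bij_betw[OF f, symmetric])
      also have "\<dots> = (\<Sum>i\<le>m. c i * f i z)" by (intro sum.cong) (auto simp: u)
      finally show ?thesis using c by simp
    qed
    then have "(\<Sum>v\<in>T. (\<lambda>z. u v * v z)) = 0" by (simp add: fun_eq_iff zero_fun_def)
    then have "\<forall>v\<in>T. u v = 0"
      using assms(1) T unfolding cfun.independent_explicit_finite_subsets by blast
    then show ?thesis using u f by (auto simp: bij_betw_def)
  qed
  moreover have "f i \<in> S" if "i \<le> m" for i using f T(1) that by (auto simp: bij_betw_def)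
  ultimately show thesis using that by blast
qed

section \<open>Comparison of the orders\<close>

theorem theorem2:
  fixes \<alpha> \<beta> \<gamma> :: "real \<Rightarrow> real"
    and k m :: nat
    and A :: "nat \<Rightarrow> complex \<Rightarrow> complex"
    and lam :: real
    and S :: "(complex \<Rightarrow> complex) set"
  assumes "admissible_scales \<alpha> \<beta> \<gamma>"
    and "k \<ge> 2"
    and "\<And>j. j < k \<Longrightarrow> A j holomorphic_on UNIV"
    and "\<exists>j<k. abc_order \<alpha> \<beta> \<gamma> (A j) \<ge> ereal lam"
    and "m = Max {j. j < k \<and> abc_order \<alpha> \<beta> \<gamma> (A j) \<ge> ereal lam}"
    and "S \<subseteq> {f. f holomorphic_on UNIV \<and> solves_lde k A f \<and>
                 abc_log_order \<alpha> \<beta> \<gamma> f < ereal lam}"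
    and "cfun.independent S"
  shows "finite S \<and> card S \<le> m"
proof (rule ccontr)
  assume "\<not> (finite S \<and> card S \<le> m)"
  then obtain f where fS: "\<forall>i\<le>m. f i \<in> S"
    and indep: "\<forall>c. (\<forall>z. (\<Sum>i\<le>m. c i * f i z) = 0) \<longrightarrow> (\<forall>i\<le>m. c i = 0)"
    by (rule independent_family[OF assms(7)])
  have classes: "\<alpha> \<in> class_L1" "\<beta> \<in> class_L2" "\<gamma> \<in> class_L3"
    using assms(1) by (simp_all add: admissible_scales_def)
  then have L: "\<alpha> \<in> class_L" "\<beta> \<in> class_L" "\<gamma> \<in> class_L"
    by (simp_all add: class_L1_def class_L2_def class_L3_def)
  define J where "J = {j. j < k \<and> abc_order \<alpha> \<beta> \<gamma> (A j) \<ge> ereal lam}"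
  have "finite J" "J \<noteq> {}" using assms(4) by (auto simp: J_def)
  then have "m \<in> J" unfolding assms(5) J_def[symmetric] by (rule Max_in)
  then have "m < k" and m_order: "abc_order \<alpha> \<beta> \<gamma> (A m) \<ge> ereal lam" by (auto simp: J_def)
  have A_order: "abc_order \<alpha> \<beta> \<gamma> (A j) < ereal lam" if "m < j" "j < k" for j
  proof (rule ccontr)
    assume "\<not> ?thesis"
    then have "j \<in> J" using that by (simp add: J_def)
    then have "j \<le> m" unfolding assms(5) J_def[symmetric] using \<open>finite J\<close> by (intro Max_ge)
    with that show False by simp
  qed
  have f: "f i holomorphic_on UNIV" "solves_lde k A (f i)" "abc_log_order \<alpha> \<beta> \<gamma> (f i) < ereal lam"
    if "i \<le> m" for i using fS that assms(6) by auto
  \<comment> \<open>The term \<open>f^(k)\<close> gets the coefficient function 1, whose proximity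
    is 0. It also supplies a coefficient above \<open>m\<close> when
    \<open>m = k - 1\<close>.\<close>
  define A' where "A' j = (if j < k then A j else (\<lambda>_. 1))" for j
  have A': "A' j holomorphic_on UNIV" for j using assms(3) by (simp add: A'_def)
  have eq: "(\<Sum>j\<le>k. A' j z * (deriv ^^ j) (f i) z) = 0" if "i \<le> m" for i z
  proof -
    have "{..k} = insert k {..<k}" by auto
    then show ?thesis using f(2)[OF that] by (simp add: solves_lde_def A'_def)
  qed
  have "\<exists>C\<ge>1. \<exists>d\<ge>4. \<forall>R\<ge>2. \<exists>r. R \<le> r \<and> r \<le> d * R \<and> (\<forall>v\<ge>1.
      (\<forall>i\<le>m. proximity (d * R) (f i) \<le> exp v) \<longrightarrow> (\<forall>j\<in>{m<..k}. proximity r (A' j) \<le> v) \<longrightarrow>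
      proximity R (A' m) \<le> C * v)"
  proof (rule coefficient_proximity_bound)
    show "\<forall>i\<le>m. c i = 0" if "\<And>z. (\<Sum>i\<le>m. c i * f i z) = 0" for c
      using indep that by simp
  qed (use \<open>m < k\<close> in \<open>simp_all add: f(1) A' eq\<close>)
  then obtain C d where "C \<ge> 1" "d \<ge> 4" and bound: "\<forall>R\<ge>2. \<exists>r. R \<le> r \<and> r \<le> d * R \<and> (\<forall>v\<ge>1.
      (\<forall>i\<le>m. proximity (d * R) (f i) \<le> exp v) \<longrightarrow> (\<forall>j\<in>{m<..k}. proximity r (A' j) \<le> v) \<longrightarrow>
      proximity R (A' m) \<le> C * v)"
    by (elim exE conjE) (rule that)
  define w where "w r = \<beta> (ln (\<gamma> r))" for r
  have w_top: "filterlim w at_top at_top" unfolding w_def by (rule scale_at_top[OF L(2,3)])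
  then have w_pos: "eventually (\<lambda>r. 0 < w r) at_top" by (auto simp: filterlim_at_top_dense)
  define If where "If = (\<lambda>i r. \<alpha> (ln (ln (nevanlinna_T r (f i))))) ` {..m}"
  define IA where "IA = (\<lambda>j r. \<alpha> (ln (nevanlinna_T r (A j)))) ` {m<..<k}"
  obtain \<mu> where "0 < \<mu>" "\<mu> < lam" and \<mu>: "eventually (\<lambda>r. \<forall>N\<in>If \<union> IA. N r \<le> \<mu> * w r) at_top"
  proof (rule Limsup_ratio_less_uniform[of "If \<union> IA" w lam])
    show "finite (If \<union> IA)" "If \<union> IA \<noteq> {}" by (auto simp: If_def IA_def)
    show "Limsup at_top (\<lambda>r. ereal (N r / w r)) < ereal lam" if "N \<in> If \<union> IA" for N
      using that f(3) A_order by (auto simp: If_def IA_def w_def abc_order_def abc_log_order_def)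
    show "0 \<le> N r" if "N \<in> If \<union> IA" for N r
      using that class_L_nonneg[OF L(1)] by (auto simp: If_def IA_def)
  qed (use w_pos in simp, rule that)
  \<comment> \<open>Room for two losses below \<open>lam\<close>: from \<open>\<mu>\<close> to
    \<open>\<nu>\<close> for the change of radius within \<open>R\<close> and \<open>d * R\<close>,
    from \<open>\<nu>\<close> to \<open>\<nu>'\<close> for the factor \<open>C\<close> in the
    characteristic.\<close>
  define \<nu> where "\<nu> = (\<mu> + lam) / 2"
  define \<nu>' where "\<nu>' = (\<nu> + lam) / 2"
  have \<nu>: "\<mu> < \<nu>" "\<nu> < \<nu>'" "\<nu>' < lam" using \<open>\<mu> < lam\<close> by (simp_all add: \<nu>_def \<nu>'_def)
  obtain R0 c where sub: "\<And>a b. a \<ge> R0 \<Longrightarrow> b \<ge> R0 \<Longrightarrow> \<alpha> (a + b) \<le> \<alpha> a + \<alpha> b + c"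
    using classes(1) unfolding class_L1_def by blast
  obtain t where t: "\<forall>u\<ge>t. \<exists>y\<ge>max 1 R0. \<alpha> y = u \<and> (\<forall>x. \<alpha> x \<le> u \<longrightarrow> x \<le> y)"
    using class_L_attains[OF L(1)] by blast
  \<comment> \<open>By the \<open>class_L1\<close> inequality, this is all that a factor
    \<open>C\<close> in front of \<open>exp y\<close> can add to \<open>\<alpha>\<close>.\<close>
  define e where "e = \<alpha> (max (ln C) R0) + c"
  have ev_\<mu>: "eventually (\<lambda>R. \<forall>x\<ge>R. \<forall>N\<in>If \<union> IA. N x \<le> \<mu> * w x) at_top"
    using \<mu> by (rule eventually_all_ge_at_top)
  have ev_w: "eventually (\<lambda>R. \<forall>x. R \<le> x \<and> x \<le> d * R \<longrightarrow> w x \<le> \<nu> / \<mu> * w R) at_top"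
    unfolding w_def using \<nu> \<open>0 < \<mu>\<close> \<open>d \<ge> 4\<close> by (intro scale_slowly_varying classes) auto
  have ev_large: "eventually (\<lambda>R. max (t / \<nu>) (e / (\<nu>' - \<nu>)) \<le> w R \<and> 2 \<le> R) at_top"
    using w_top[unfolded filterlim_at_top, rule_format] eventually_ge_at_top by (rule eventually_conj)
  have "eventually (\<lambda>R. ereal (\<alpha> (ln (nevanlinna_T R (A m))) / w R) \<le> ereal \<nu>') at_top"
    using ev_\<mu> ev_w ev_large w_pos
  proof eventually_elim
    case (elim R)
    have N_le: "N x \<le> \<nu> * w R" if "N \<in> If \<union> IA" "R \<le> x" "x \<le> d * R" for N x
    proof -
      have "N x \<le> \<mu> * w x" using elim(1) that by blast
      also have "\<dots> \<le> \<mu> * (\<nu> / \<mu> * w R)" using elim(2) that \<open>0 < \<mu>\<close> by (intro mult_left_mono) auto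
      finally show ?thesis using \<open>0 < \<mu>\<close> by simp
    qed
    have "t / \<nu> \<le> w R" "e / (\<nu>' - \<nu>) \<le> w R" "R \<ge> 2" using elim(3) by auto
    then have "t \<le> \<nu> * w R" and e: "e \<le> (\<nu>' - \<nu>) * w R"
      using \<nu> \<open>0 < \<mu>\<close> by (simp_all add: divide_le_eq mult.commute)
    \<comment> \<open>The bound will be applied with \<open>v = exp y\<close>. By the choice of
      \<open>y\<close>, it dominates \<open>ln T\<close> of the higher coefficients and
      \<open>ln (ln T)\<close> of the solutions simultaneously, at every radius between
      \<open>R\<close> and \<open>d * R\<close>.\<close>
    then obtain y where y: "y \<ge> 1" "y \<ge> R0" "\<alpha> y = \<nu> * w R"
      and le_y: "\<And>x. \<alpha> x \<le> \<nu> * w R \<Longrightarrow> x \<le> y"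
      using t[rule_format, of "\<nu> * w R"] by auto
    \<comment> \<open>For nonpositive \<open>x\<close> the claim holds whatever value
      \<open>ln x\<close> has, so no lower bound on the characteristics is required.\<close>
    have le_exp: "x \<le> exp z" if "ln x \<le> z" for x z :: real
    proof (cases "x > 0")
      case True
      then have "x = exp (ln x)" by simp
      also have "\<dots> \<le> exp z" using that by simp
      finally show ?thesis .
    next
      case False
      then show ?thesis by (meson exp_ge_zero not_less order_trans)
    qed
    obtain r where r: "R \<le> r" "r \<le> d * R" and AR: "\<forall>v\<ge>1.
      (\<forall>i\<le>m. proximity (d * R) (f i) \<le> exp v) \<longrightarrow> (\<forall>j\<in>{m<..k}. proximity r (A' j) \<le> v) \<longrightarrow>
      proximity R (A' m) \<le> C * v"
      using bound \<open>R \<ge> 2\<close> by blast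
    have dR: "R \<le> d * R" using r by simp
    have "proximity R (A' m) \<le> C * exp y"
    proof (intro AR[rule_format])
      show "1 \<le> exp y" using y by simp
      fix i assume i: "i \<le> m"
      have "\<alpha> (ln (ln (nevanlinna_T (d * R) (f i)))) \<le> \<nu> * w R"
        using N_le[of "\<lambda>r. \<alpha> (ln (ln (nevanlinna_T r (f i))))" "d * R"] i dR by (simp add: If_def)
      then have "ln (ln (nevanlinna_T (d * R) (f i))) \<le> y" by (rule le_y)
      then have "ln (nevanlinna_T (d * R) (f i)) \<le> exp y" by (rule le_exp)
      then have "nevanlinna_T (d * R) (f i) \<le> exp (exp y)" by (rule le_exp)
      then show "proximity (d * R) (f i) \<le> exp (exp y)" using nevanlinna_T_entire[OF f(1)[OF i]] by simp
    next
      fix j assume j: "j \<in> {m<..k}"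
      show "proximity r (A' j) \<le> exp y"
      proof (cases "j = k")
        case True
        then show ?thesis by (simp add: A'_def proximity_def log_plus_def)
      next
        case False
        then have j: "m < j" "j < k" using j by auto
        have "\<alpha> (ln (nevanlinna_T r (A j))) \<le> \<nu> * w R"
          using N_le[of "\<lambda>r. \<alpha> (ln (nevanlinna_T r (A j)))" r] j r by (simp add: IA_def)
        then have "ln (nevanlinna_T r (A j)) \<le> y" by (rule le_y)
        then have "nevanlinna_T r (A j) \<le> exp y" by (rule le_exp)
        then show ?thesis using nevanlinna_T_entire[OF assms(3)[OF j(2)]] j by (simp add: A'_def)
      qed
    qed
    then have T: "nevanlinna_T R (A m) \<le> C * exp y"
      using nevanlinna_T_entire[OF assms(3)[OF \<open>m < k\<close>]] \<open>m < k\<close> by (simp add: A'_def)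
    have "ln (nevanlinna_T R (A m)) \<le> ln C + y"
    proof (cases "nevanlinna_T R (A m) = 0")
      \<comment> \<open>The default \<open>ln 0 = 0\<close> is below \<open>ln C + y\<close> because
        \<open>C \<ge> 1\<close> and \<open>y \<ge> 1\<close>.\<close>
      case True
      then show ?thesis using \<open>C \<ge> 1\<close> y by simp
    next
      case False
      then have "0 < nevanlinna_T R (A m)"
        using proximity_nonneg[of R "A m"] nevanlinna_T_entire[OF assms(3)[OF \<open>m < k\<close>]] by simp
      then have "ln (nevanlinna_T R (A m)) \<le> ln (C * exp y)" using T by (intro ln_mono) auto
      also have "\<dots> = ln C + y" using \<open>C \<ge> 1\<close> by (simp add: ln_mult_pos)
      finally show ?thesis .
    qed
    then have "\<alpha> (ln (nevanlinna_T R (A m))) \<le> \<alpha> (max (ln C) R0 + y)"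
      by (intro class_L_mono[OF L(1)]) auto
    also have "\<dots> \<le> \<alpha> (max (ln C) R0) + \<alpha> y + c" using y by (intro sub) auto
    also have "\<dots> = e + \<nu> * w R" by (simp add: e_def y)
    also have "\<dots> \<le> \<nu>' * w R" using e by (simp add: algebra_simps)
    finally show ?case using elim(4) by (simp add: field_simps)
  qed
  then have "abc_order \<alpha> \<beta> \<gamma> (A m) \<le> ereal \<nu>'"
    unfolding abc_order_def w_def by (rule Limsup_bounded)
  with m_order have "ereal lam \<le> ereal \<nu>'" by (rule order_trans)
  with \<nu> show False by simp
qed

end
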